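(* Let $G=\langle x_1,\dots,x_n \mid r_1,\dots,r_m\rangle$ be a group given by a finite presentation, let $A=\{x_1^{\pm1},\dots,x_n^{\pm1}\}$, and let $(L=L(M),A,M_{=},M_{x_1},\dots,M_{x_n^{-1}})$ be an automatic structure with uniqueness for $G$. Then there is a single partial algorithm (uniform in $H$) which, taking as input a finite list of words $v_1,\dots,v_t\in A^{*}$ and letting $H=\langle \overline{v_1},\dots,\overline{v_t}\rangle\le G$ be the subgroup they generate, behaves as follows: (a) if $H$ is $L$-rational, the algorithm eventually stops and outputs a finite state automaton $M_H$ recognizing the language $L_H=\pi^{-1}(H)\cap L$; (b) if $H$ is not $L$-rational, the algorithm runs forever.
   Context: For a group $G$ with a finite generating set $A$ closed under taking inverses, $A^{*}$ denotes the free monoid on $A$, $\pi\colon A^{*}\to G$ the natural monoid homomorphism, and $\overline{w}=\pi(w)$ for $w\in A^{*}$. $L(M)$ denotes the language accepted by a finite state automaton $M$. An automatic structure for $G$ over $A$ is a tuple $(L=L(M),A,M_{=},(M_a)_{a\in A})$ where $M$ is a finite state automaton over $A$ accepting the regular language $L\subseteq A^{*}$ with $\pi(L)=G$, $M_{=}$ is a finite state automaton accepting (in the usual padded, synchronous two-tape sense) exactly the pairs $(w,u)\in L\times L$ with $\overline{w}=\overline{u}$, and for each $a\in A$, $M_a$ is a finite state automaton accepting (in the same sense) exactly the pairs $(w,u)\in L\times L$ with $\overline{wa}=\overline{u}$. It is an automatic structure with uniqueness if for every $g\in G$ there is exactly one $w\in L$ with $\overline{w}=g$. A subgroup $H\le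 G$ is $L$-rational if its full preimage in $L$, $L_H=L\cap\pi^{-1}(H)$, is a regular language. *)

theory Defs
  imports "HOL-Algebra.Generated_Groups" "HOL-Library.Nat_Bijection"
begin

section \<open>Groups given by a finite presentation\<close>

text \<open>
  \<open>Gen i\<close> and \<open>Inv i\<close> are the formal letters for the \<open>i\<close>-th generator and its inverse.
  The letters of the alphabet are kept distinct even if they become equal in the group.
\<close>

datatype letter = Gen nat | Inv nat

primrec letter_inv :: "letter \<Rightarrow> letter" where
  "letter_inv (Gen i) = Inv i"
| "letter_inv (Inv i) = Gen i"

definition letters :: "nat \<Rightarrow> letter set" where
  "letters n = Gen ` {..<n} \<union> Inv ` {..<n}"

inductive free_eq :: "nat \<Rightarrow> letter list \<Rightarrow> letter list \<Rightarrow> bool" for n where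
  refl: "u \<in> lists (letters n) \<Longrightarrow> free_eq n u u"
| sym: "free_eq n u v \<Longrightarrow> free_eq n v u"
| trans: "free_eq n u v \<Longrightarrow> free_eq n v w \<Longrightarrow> free_eq n u w"
| append: "free_eq n u u' \<Longrightarrow> free_eq n v v' \<Longrightarrow> free_eq n (u @ v) (u' @ v')"
| cancel: "a \<in> letters n \<Longrightarrow> free_eq n [a, letter_inv a] []"

definition free_class :: "nat \<Rightarrow> letter list \<Rightarrow> letter list set" where
  "free_class n u = {v. free_eq n u v}"

definition free_group :: "nat \<Rightarrow> letter list set monoid" where
  "free_group n =
     \<lparr>carrier = free_class n ` lists (letters n),
      mult = (\<lambda>X Y. \<Union>u\<in>X. \<Union>v\<in>Y. free_class n (u @ v)),
      one = free_class n []\<rparr>"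

definition normal_closure :: "('a, 'b) monoid_scheme \<Rightarrow> 'a set \<Rightarrow> 'a set" where
  "normal_closure G S = \<Inter>{N. N \<lhd> G \<and> S \<subseteq> N}"

definition relator_subgroup :: "nat \<Rightarrow> letter list list \<Rightarrow> letter list set set" where
  "relator_subgroup n rs = normal_closure (free_group n) (free_class n ` set rs)"

definition presented_group :: "nat \<Rightarrow> letter list list \<Rightarrow> letter list set set monoid" where
  "presented_group n rs = free_group n Mod relator_subgroup n rs"

definition presented_gen :: "nat \<Rightarrow> letter list list \<Rightarrow> letter \<Rightarrow> letter list set set" where
  "presented_gen n rs a = relator_subgroup n rs #>\<^bsub>free_group n\<^esub> free_class n [a]"

text \<open>The monoid homomorphism from words to \<open>G\<close> that extends \<open>\<mu>\<close>:\<close>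

definition word_val :: "('g, 'b) monoid_scheme \<Rightarrow> ('a \<Rightarrow> 'g) \<Rightarrow> 'a list \<Rightarrow> 'g" where
  "word_val G \<mu> w = foldr (\<lambda>a g. \<mu> a \<otimes>\<^bsub>G\<^esub> g) w \<one>\<^bsub>G\<^esub>"

section \<open>Finite state automata\<close>

text \<open>
  A deterministic automaton is given by its initial state, a finite transition table and its
  accepting states, so it is a finite object and can be the output of an algorithm.
  The table is read with \<^const>\<open>map_of\<close>; on a missing entry the automaton rejects.
  States are numbered; every finite state set can be numbered.
\<close>

datatype 'a fsa = FSA (initial: nat) (table: "((nat \<times> 'a) \<times> nat) list") (accepting: "nat list")

primrec fsa_run :: "'a fsa \<Rightarrow> nat \<Rightarrow> 'a list \<Rightarrow> nat option" where
  "fsa_run M q [] = Some q"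
| "fsa_run M q (a # w) =
     (case map_of (table M) (q, a) of None \<Rightarrow> None | Some q' \<Rightarrow> fsa_run M q' w)"

definition fsa_lang :: "'a fsa \<Rightarrow> 'a list set" where
  "fsa_lang M = {w. \<exists>q \<in> set (accepting M). fsa_run M (initial M) w = Some q}"

definition fsa_over :: "'a set \<Rightarrow> 'a fsa \<Rightarrow> bool" where
  "fsa_over A M \<longleftrightarrow> (\<forall>((q, a), q') \<in> set (table M). a \<in> A)"

definition regular :: "'a set \<Rightarrow> 'a list set \<Rightarrow> bool" where
  "regular A K \<longleftrightarrow> (\<exists>M. fsa_over A M \<and> fsa_lang M = K)"

text \<open>\<open>None\<close> is the padding symbol, appended to the shorter of the two words.\<close>

fun pad :: "'a list \<Rightarrow> 'a list \<Rightarrow> ('a option \<times> 'a option) list" where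
  "pad [] [] = []"
| "pad (a # w) [] = (Some a, None) # pad w []"
| "pad [] (b # u) = (None, Some b) # pad [] u"
| "pad (a # w) (b # u) = (Some a, Some b) # pad w u"

definition pad_alphabet :: "'a set \<Rightarrow> ('a option \<times> 'a option) set" where
  "pad_alphabet A = (insert None (Some ` A) \<times> insert None (Some ` A)) - {(None, None)}"

definition accepts_pairs ::
    "'a set \<Rightarrow> ('a option \<times> 'a option) fsa \<Rightarrow> ('a list \<times> 'a list) set \<Rightarrow> bool" where
  "accepts_pairs A M R \<longleftrightarrow>
     fsa_over (pad_alphabet A) M \<and> fsa_lang M = {pad w u | w u. (w, u) \<in> R}"

section \<open>Automatic structures\<close>

text \<open>The alphabet \<open>A\<close> is mapped to \<open>G\<close> by \<open>\<mu>\<close>.\<close>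

definition automatic_structure ::
    "('g, 'b) monoid_scheme \<Rightarrow> 'a set \<Rightarrow> ('a \<Rightarrow> 'g) \<Rightarrow> 'a fsa \<Rightarrow>
     ('a option \<times> 'a option) fsa \<Rightarrow> ('a \<Rightarrow> ('a option \<times> 'a option) fsa) \<Rightarrow> bool" where
  "automatic_structure G A \<mu> M Meq Mmul \<longleftrightarrow>
     fsa_over A M \<and>
     word_val G \<mu> ` fsa_lang M = carrier G \<and>
     accepts_pairs A Meq
       {(w, u). w \<in> fsa_lang M \<and> u \<in> fsa_lang M \<and> word_val G \<mu> w = word_val G \<mu> u} \<and>
     (\<forall>a\<in>A. accepts_pairs A (Mmul a)
       {(w, u). w \<in> fsa_lang M \<and> u \<in> fsa_lang M \<and> word_val G \<mu> (w @ [a]) = word_val G \<mu> u})"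

definition automatic_structure_unique ::
    "('g, 'b) monoid_scheme \<Rightarrow> 'a set \<Rightarrow> ('a \<Rightarrow> 'g) \<Rightarrow> 'a fsa \<Rightarrow>
     ('a option \<times> 'a option) fsa \<Rightarrow> ('a \<Rightarrow> ('a option \<times> 'a option) fsa) \<Rightarrow> bool" where
  "automatic_structure_unique G A \<mu> M Meq Mmul \<longleftrightarrow>
     automatic_structure G A \<mu> M Meq Mmul \<and>
     (\<forall>g\<in>carrier G. \<exists>!w. w \<in> fsa_lang M \<and> word_val G \<mu> w = g)"

definition preimage_in ::
    "('g, 'b) monoid_scheme \<Rightarrow> ('a \<Rightarrow> 'g) \<Rightarrow> 'a list set \<Rightarrow> 'g set \<Rightarrow> 'a list set" where
  "preimage_in G \<mu> L H = {w \<in> L. word_val G \<mu> w \<in> H}"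

definition rational_subgroup ::
    "('g, 'b) monoid_scheme \<Rightarrow> 'a set \<Rightarrow> ('a \<Rightarrow> 'g) \<Rightarrow> 'a list set \<Rightarrow> 'g set \<Rightarrow> bool" where
  "rational_subgroup G A \<mu> L H \<longleftrightarrow> subgroup H G \<and> regular A (preimage_in G \<mu> L H)"

section \<open>Partial algorithms\<close>

text \<open>
  Algorithms are programs for partial recursive functions (Kleene). \<open>computes p xs y\<close> says that
  \<open>p\<close> stops on input \<open>xs\<close> with output \<open>y\<close>. The last rule is unbounded search: all values before
  the first zero have to be defined.
\<close>

datatype program =
    Zero
  | Succ
  | Proj nat
  | Comp program "program list"
  | Prec program program
  | Mu program

inductive computes :: "program \<Rightarrow> nat list \<Rightarrow> nat \<Rightarrow> bool" where
  zero: "computes Zero xs 0"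
| succ: "computes Succ [x] (Suc x)"
| proj: "i < length xs \<Longrightarrow> computes (Proj i) xs (xs ! i)"
| comp: "list_all2 (\<lambda>p y. computes p xs y) ps ys \<Longrightarrow> computes p ys z \<Longrightarrow>
    computes (Comp p ps) xs z"
| prec_0: "computes p xs y \<Longrightarrow> computes (Prec p q) (0 # xs) y"
| prec_Suc: "computes (Prec p q) (k # xs) y \<Longrightarrow> computes q (k # y # xs) z \<Longrightarrow>
    computes (Prec p q) (Suc k # xs) z"
| mu: "computes p (k # xs) 0 \<Longrightarrow> (\<And>i. i < k \<Longrightarrow> \<exists>y. computes p (i # xs) (Suc y)) \<Longrightarrow>
    computes (Mu p) xs k"

definition runs_forever :: "program \<Rightarrow> nat list \<Rightarrow> bool" where
  "runs_forever p xs \<longleftrightarrow> (\<nexists>y. computes p xs y)"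

text \<open>The numbers by which inputs and outputs are presented to a program:\<close>

primrec letter_code :: "letter \<Rightarrow> nat" where
  "letter_code (Gen i) = 2 * i"
| "letter_code (Inv i) = 2 * i + 1"

definition word_code :: "letter list \<Rightarrow> nat" where
  "word_code w = list_encode (map letter_code w)"

definition words_code :: "letter list list \<Rightarrow> nat" where
  "words_code vs = list_encode (map word_code vs)"

definition fsa_code :: "letter fsa \<Rightarrow> nat" where
  "fsa_code M = prod_encode (initial M, prod_encode
     (list_encode (map (\<lambda>((q, a), q'). prod_encode (prod_encode (q, letter_code a), q')) (table M)),
      list_encode (accepting M)))"

section \<open>Basic facts\<close>

lemma computes_deterministic: "computes p xs y \<Longrightarrow> computes p xs z \<Longrightarrow> z = y"
proof (induction arbitrary: z rule: computes.induct)
  case (zero xs) then show ?case by cases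
next
  case (succ x) then show ?case by cases
next
  case (proj i xs) from proj(2) show ?case by cases
next
  case (comp xs ps ys p y)
  from comp.prems obtain ys' where
    ys': "list_all2 (\<lambda>p y. computes p xs y) ps ys'" "computes p ys' z"
    by cases
  have "ys' = ys"
    using comp.IH(1) ys'(1) by (auto simp: list_all2_conv_all_nth intro!: nth_equalityI)
  then show ?case using comp.IH(2) ys'(2) by simp
next
  case (prec_0 p xs y q) from prec_0.prems show ?case by cases (auto intro: prec_0.IH)
next
  case (prec_Suc p q k xs y z') from prec_Suc.prems show ?case
    by cases (use prec_Suc.IH in blast)
next
  case (mu p k xs)
  from mu.prems show ?case
  proof cases
    case mu': mu
    show ?thesis
    proof (rule linorder_cases[of z k])
      assume "z < k"
      then show ?thesis using mu.IH(2) mu'(1) by force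
    next
      assume "k < z"
      then show ?thesis using mu'(2) mu.IH(1) by force
    qed
  qed
qed

lemma letter_code_inject: "letter_code a = letter_code b \<Longrightarrow> a = b"
  by (cases a; cases b) (auto, presburger+)

lemma words_code_inject: "words_code vs = words_code ws \<Longrightarrow> vs = ws"
proof -
  have "inj letter_code" by (auto intro: injI letter_code_inject)
  then have "inj word_code"
    by (auto intro!: injI simp: word_code_def list_encode_eq)
  then show "words_code vs = words_code ws \<Longrightarrow> vs = ws"
    by (auto simp: words_code_def list_encode_eq)
qed

lemma fsa_code_inject: "fsa_code M = fsa_code N \<Longrightarrow> M = N"
proof -
  have "inj (\<lambda>((q, a), q'). prod_encode (prod_encode (q, letter_code a), q'))"
    by (auto intro!: injI dest: letter_code_inject)
  then show "fsa_code M = fsa_code N \<Longrightarrow> M = N"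
    by (auto simp: fsa_code_def list_encode_eq intro!: fsa.expand)
qed

lemma letter_inv_letters: "a \<in> letters n \<Longrightarrow> letter_inv a \<in> letters n"
  by (auto simp: letters_def)

lemma free_eq_lists:
  "free_eq n u v \<Longrightarrow> u \<in> lists (letters n) \<and> v \<in> lists (letters n)"
  by (induction rule: free_eq.induct) (auto intro: letter_inv_letters)

lemma free_class_eq_iff:
  "u \<in> lists (letters n) \<Longrightarrow> free_class n u = free_class n v \<longleftrightarrow> free_eq n u v"
  by (auto simp: free_class_def intro: free_eq.intros)

lemma free_group_mult:
  assumes "u \<in> lists (letters n)" "v \<in> lists (letters n)"
  shows "free_class n u \<otimes>\<^bsub>free_group n\<^esub> free_class n v = free_class n (u @ v)"
proof -
  have "free_class n (u' @ v') = free_class n (u @ v)"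
    if "free_eq n u u'" "free_eq n v v'" for u' v'
    using that assms free_eq.append[OF that] by (subst eq_commute, subst free_class_eq_iff) auto
  moreover have "u \<in> free_class n u" "v \<in> free_class n v"
    using assms by (auto simp: free_class_def intro: free_eq.refl)
  ultimately have "(\<Union>u'\<in>free_class n u. \<Union>v'\<in>free_class n v. free_class n (u' @ v'))
      = free_class n (u @ v)"
    unfolding free_class_def mem_Collect_eq by blast
  then show ?thesis
    by (simp add: free_group_def)
qed

lemma free_inverse:
  "u \<in> lists (letters n) \<Longrightarrow> free_eq n (rev (map letter_inv u) @ u) []"
proof (induction u)
  case Nil then show ?case by (auto intro: free_eq.refl)
next
  case (Cons a u)
  then have a: "a \<in> letters n" and u: "u \<in> lists (letters n)" by auto
  have "letter_inv (letter_inv a) = a" by (cases a) auto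
  then have "free_eq n [letter_inv a, a] []"
    using free_eq.cancel[OF letter_inv_letters[OF a]] by simp
  moreover have r: "rev (map letter_inv u) \<in> lists (letters n)"
    using u by (auto simp: letter_inv_letters)
  ultimately have "free_eq n (rev (map letter_inv u) @ [letter_inv a, a] @ u)
      (rev (map letter_inv u) @ [] @ u)"
    using u by (intro free_eq.append) (auto intro: free_eq.refl)
  then show ?case using Cons.IH[OF u] free_eq.trans by fastforce
qed

lemma group_free_group: "group (free_group n)"
proof (rule groupI)
  have carr: "carrier (free_group n) = free_class n ` lists (letters n)"
    and one: "\<one>\<^bsub>free_group n\<^esub> = free_class n []"
    by (simp_all add: free_group_def)
  show "\<one>\<^bsub>free_group n\<^esub> \<in> carrier (free_group n)"
    by (auto simp: carr one)
  fix x assume "x \<in> carrier (free_group n)"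
  then obtain u where u: "u \<in> lists (letters n)" "x = free_class n u" by (auto simp: carr)
  show "\<one>\<^bsub>free_group n\<^esub> \<otimes>\<^bsub>free_group n\<^esub> x = x"
    using u by (simp add: one free_group_mult)
  show "\<exists>y\<in>carrier (free_group n). y \<otimes>\<^bsub>free_group n\<^esub> x = \<one>\<^bsub>free_group n\<^esub>"
  proof
    have r: "rev (map letter_inv u) \<in> lists (letters n)"
      using u by (auto simp: letter_inv_letters)
    then show "free_class n (rev (map letter_inv u)) \<in> carrier (free_group n)"
      unfolding carr by (rule imageI)
    show "free_class n (rev (map letter_inv u)) \<otimes>\<^bsub>free_group n\<^esub> x = \<one>\<^bsub>free_group n\<^esub>"
      using free_inverse[OF u(1)] free_eq_lists[OF free_inverse[OF u(1)]] r u
      by (simp add: one free_group_mult free_class_eq_iff)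
  qed
  fix y assume "y \<in> carrier (free_group n)"
  then obtain v where v: "v \<in> lists (letters n)" "y = free_class n v" by (auto simp: carr)
  have uv: "u @ v \<in> lists (letters n)" using u v by auto
  then show "x \<otimes>\<^bsub>free_group n\<^esub> y \<in> carrier (free_group n)"
    using u v unfolding carr by (simp add: free_group_mult)
  fix z assume "z \<in> carrier (free_group n)"
  then obtain w where w: "w \<in> lists (letters n)" "z = free_class n w" by (auto simp: carr)
  have "v @ w \<in> lists (letters n)" using v w by auto
  then show "x \<otimes>\<^bsub>free_group n\<^esub> y \<otimes>\<^bsub>free_group n\<^esub> z
      = x \<otimes>\<^bsub>free_group n\<^esub> (y \<otimes>\<^bsub>free_group n\<^esub> z)"
    using u v w uv by (simp add: free_group_mult del: append_in_lists_conv)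
qed

lemma (in group) normal_normal_closure:
  assumes "S \<subseteq> carrier G"
  shows "normal_closure G S \<lhd> G" "S \<subseteq> normal_closure G S"
proof -
  have "carrier G \<lhd> G"
    by (auto simp: normal_inv_iff subgroup_self)
  then have ne: "{N. N \<lhd> G \<and> S \<subseteq> N} \<noteq> {}" using assms by blast
  have "subgroup (normal_closure G S) G"
    unfolding normal_closure_def
    by (rule subgroups_Inter) (use ne in \<open>auto simp: normal_inv_iff\<close>)
  then show "normal_closure G S \<lhd> G"
    by (auto simp: normal_inv_iff normal_closure_def)
  show "S \<subseteq> normal_closure G S"
    by (auto simp: normal_closure_def)
qed

lemma normal_relator_subgroup:
  assumes "set rs \<subseteq> lists (letters n)"
  shows "relator_subgroup n rs \<lhd> free_group n"
  unfolding relator_subgroup_def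
  using assms by (intro group.normal_normal_closure(1)[OF group_free_group])
    (auto simp: free_group_def)

lemma group_presented_group:
  "set rs \<subseteq> lists (letters n) \<Longrightarrow> group (presented_group n rs)"
  unfolding presented_group_def by (intro normal.factorgroup_is_group normal_relator_subgroup)

lemma presented_gen_closed:
  assumes "set rs \<subseteq> lists (letters n)" "a \<in> letters n"
  shows "presented_gen n rs a \<in> carrier (presented_group n rs)"
  using assms by (auto simp: presented_gen_def presented_group_def FactGroup_def RCOSETS_def
      free_group_def)

lemma presented_gen_inv:
  assumes "set rs \<subseteq> lists (letters n)" "a \<in> letters n"
  shows "presented_gen n rs a \<otimes>\<^bsub>presented_group n rs\<^esub> presented_gen n rs (letter_inv a)
    = \<one>\<^bsub>presented_group n rs\<^esub>"
proof -
  interpret N: normal "relator_subgroup n rs" "free_group n"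
    by (rule normal_relator_subgroup) fact
  have a': "letter_inv a \<in> letters n" using assms(2) by (rule letter_inv_letters)
  have carr: "free_class n [a] \<in> carrier (free_group n)"
    "free_class n [letter_inv a] \<in> carrier (free_group n)"
    using assms(2) a' by (auto simp: free_group_def)
  have "free_class n [a] \<otimes>\<^bsub>free_group n\<^esub> free_class n [letter_inv a] = \<one>\<^bsub>free_group n\<^esub>"
    using assms(2) a' free_eq.cancel[OF assms(2)]
    by (simp add: free_group_mult) (simp add: free_group_def free_class_eq_iff)
  then show ?thesis
    using carr by (simp add: presented_gen_def presented_group_def FactGroup_def N.rcos_sum
        N.subset)
qed

end

theory Submission
  imports Defs
begin

text \<open>
  Write \<open>\<pi>\<close> for the evaluation of words and \<open>H\<close> for the subgroup generated by the input words. The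
  algorithm guesses an automaton \<open>N\<close> together with a certificate that \<open>N\<close> accepts \<open>L\<^sub>H\<close>, and it stops at
  the first pair that passes a decidable check. Since \<open>L\<close> represents every element exactly once, \<open>N\<close>
  accepts \<open>L\<^sub>H\<close> if and only if it accepts a set of words of \<open>L\<close> that contains the representative of
  \<open>1\<close>, is mapped into \<open>H\<close>, and is invariant under right multiplication by the generators of \<open>H\<close> and
  their inverses. Each of the last two properties concerns infinitely many words, and each has a
  finite certificate.

  For the invariance under \<open>v = a\<^sub>1 \<dots> a\<^sub>k\<close> the certificate is a chain of automata
  \<open>N = N\<^sub>0, N\<^sub>1, \<dots>, N\<^sub>k = N\<close> in which \<open>N\<^sub>i\<close> accepts the representatives of the elements \<open>g\<close> with
  \<open>g a\<^bsub>i+1\<^esub> \<dots> a\<^sub>k \<in> H\<close>. Two neighbours are compared on all pairs accepted by the multiplier automaton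
  of \<open>a\<^sub>i\<close>, which is a reachability question in a finite product automaton (\<open>semidecidable_translation\<close>).
  If \<open>L\<^sub>H\<close> is regular, then so are all languages in the chain, because a regular relation maps regular
  languages to regular ones (\<open>finite_residuals_projection\<close>).

  For the inclusion in \<open>H\<close> the certificate labels each state \<open>q\<close> with a word \<open>c\<close> such that every word
  that leads to \<open>q\<close> lies in the coset \<open>H c\<close>. This can be checked transition by transition. Such labels
  exist if \<open>N\<close> accepts \<open>L\<^sub>H\<close> and has no superfluous transitions: if \<open>x\<close> and \<open>y\<close> lead to the same state,
  then some \<open>z\<close> completes both to words in \<open>L\<^sub>H\<close>, hence \<open>H x = H y\<close>. The equation \<open>H x = H y\<close> is itself
  semidecidable, by walking through representatives along the multiplier automata
  (\<open>same_coset_iff\<close>). So \<open>N\<close> has a certificate only if it accepts \<open>L\<^sub>H\<close> (\<open>certified_sound\<close>), and if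
  \<open>L\<^sub>H\<close> is regular, a suitable \<open>N\<close> has one (\<open>certified_complete\<close>).

  To obtain an actual program, predicates and functions are shown to be computable or semidecidable by
  closure rules, over types that are in bijection with the natural numbers. A semidecidable relation
  between inputs and outputs then yields one program that searches for an output
  (\<open>semidecidable_search\<close>).
\<close>

section \<open>Computable functions between encoded types\<close>

text \<open>
  The coding is a bijection, so that every number is a code: an unbounded search over numbers is a
  search over all values of a type, and a program never meets an invalid input.
\<close>

class encodable =
  fixes encode :: "'a \<Rightarrow> nat"
  assumes bij_encode: "bij encode"

definition decode :: "nat \<Rightarrow> 'a::encodable" where
  "decode = inv_into UNIV encode"

lemma decode_encode [simp]: "decode (encode x) = x"
  unfolding decode_def by (simp add: bij_encode bij_is_inj)

lemma encode_decode [simp]: "encode (decode n) = n"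
  unfolding decode_def by (simp add: bij_encode bij_is_surj surj_f_inv_f)

lemma encode_eq_iff [simp]: "encode x = encode y \<longleftrightarrow> x = y"
  using bij_encode by (metis decode_encode)

instantiation nat :: encodable
begin
definition encode_nat :: "nat \<Rightarrow> nat" where "encode_nat = id"
instance by standard (simp add: encode_nat_def)
end

instantiation prod :: (encodable, encodable) encodable
begin
definition encode_prod :: "'a \<times> 'b \<Rightarrow> nat" where
  "encode_prod = prod_encode \<circ> map_prod encode encode"
instance
proof
  have "bij (map_prod encode encode :: 'a \<times> 'b \<Rightarrow> nat \<times> nat)"
    by (rule o_bij[where g = "map_prod decode decode"]) (simp_all add: fun_eq_iff)
  then show "bij (encode :: 'a \<times> 'b \<Rightarrow> nat)"
    unfolding encode_prod_def by (rule bij_comp[OF _ bij_prod_encode])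
qed
end

instantiation option :: (encodable) encodable
begin
definition encode_option :: "'a option \<Rightarrow> nat" where
  "encode_option = case_option 0 (Suc \<circ> encode)"
instance
  by standard (rule o_bij[where g = "\<lambda>n. case n of 0 \<Rightarrow> None | Suc m \<Rightarrow> Some (decode m)"],
    auto simp: encode_option_def fun_eq_iff split: option.split nat.split)
end

instantiation list :: (encodable) encodable
begin
definition encode_list :: "'a list \<Rightarrow> nat" where
  "encode_list = list_encode \<circ> map encode"
instance
proof
  have "bij (map encode :: 'a list \<Rightarrow> nat list)"
    by (rule o_bij[where g = "map decode"]) (simp_all add: fun_eq_iff o_def)
  then show "bij (encode :: 'a list \<Rightarrow> nat)"
    unfolding encode_list_def by (rule bij_comp[OF _ bij_list_encode])
qed
end

instantiation letter :: encodable
begin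
definition encode_letter :: "letter \<Rightarrow> nat" where
  "encode_letter = letter_code"
instance
proof
  have "letter_code (if even n then Gen (n div 2) else Inv (n div 2)) = n" for n
    by simp
  moreover have "(if even (letter_code a) then Gen (letter_code a div 2)
      else Inv (letter_code a div 2)) = a" for a
    by (cases a) simp_all
  ultimately show "bij (encode :: letter \<Rightarrow> nat)"
    unfolding encode_letter_def
    by (intro o_bij[where g = "\<lambda>n. if even n then Gen (n div 2) else Inv (n div 2)"])
      (simp_all only: fun_eq_iff o_def id_def simp_thms)
qed
end

definition fsa_tuple :: "'a fsa \<Rightarrow> nat \<times> ((nat \<times> 'a) \<times> nat) list \<times> nat list" where
  "fsa_tuple M = (initial M, table M, accepting M)"

lemma bij_fsa_tuple: "bij fsa_tuple"
  by (rule o_bij[where g = "\<lambda>(i, t, a). FSA i t a"]) (auto simp: fsa_tuple_def)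

instantiation fsa :: (encodable) encodable
begin
definition encode_fsa :: "'a fsa \<Rightarrow> nat" where
  "encode_fsa = encode \<circ> fsa_tuple"
instance
  by standard (simp add: encode_fsa_def bij_comp bij_encode bij_fsa_tuple)
end

lemma encode_nat [simp]: "encode (n :: nat) = n"
  by (simp add: encode_nat_def)

lemma encode_Pair: "encode (x, y) = prod_encode (encode x, encode y)"
  by (simp add: encode_prod_def)

lemma encode_None [simp]: "encode None = 0"
  by (simp add: encode_option_def)

lemma encode_Some: "encode (Some x) = Suc (encode x)"
  by (simp add: encode_option_def)

lemma encode_Nil [simp]: "encode [] = 0"
  by (simp add: encode_list_def)

lemma encode_Cons: "encode (x # xs) = Suc (encode (x, xs))"
  by (simp add: encode_list_def encode_Pair)

lemma encode_words: "encode vs = words_code vs"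
proof -
  have "(encode :: letter list \<Rightarrow> nat) = word_code"
    by (simp add: fun_eq_iff encode_list_def word_code_def encode_letter_def)
  then show ?thesis
    by (simp add: encode_list_def[where 'a = "letter list"] words_code_def)
qed

lemma encode_letter_fsa: "encode M = fsa_code M"
proof -
  have "(encode :: (nat \<times> letter) \<times> nat \<Rightarrow> nat) =
      (\<lambda>((q, a), q'). prod_encode (prod_encode (q, letter_code a), q'))"
    by (auto simp: encode_Pair encode_letter_def)
  moreover have "map (encode :: nat \<Rightarrow> nat) = id"
    by (simp add: encode_nat_def fun_eq_iff)
  ultimately show ?thesis
    by (simp add: encode_fsa_def fsa_tuple_def fsa_code_def encode_Pair encode_list_def)
qed

text \<open>
  A code bounds the length of the list, so it can serve as the number of rounds of a loop over the list.
\<close>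

lemma length_le_encode: "length xs \<le> encode xs"
proof (induction xs)
  case (Cons x xs)
  then show ?case
    using le_prod_encode_2[of "encode xs" "encode x"] by (simp add: encode_Cons encode_Pair)
qed simp

subsection \<open>Arithmetic on codes\<close>

lemma computes_Proj: "i < length xs \<Longrightarrow> xs ! i = y \<Longrightarrow> computes (Proj i) xs y"
  using computes.proj by blast

lemma computes_Comp1: "computes q xs a \<Longrightarrow> computes p [a] y \<Longrightarrow> computes (Comp p [q]) xs y"
  by (rule computes.comp[of _ _ "[a]"]) auto

lemma computes_Comp2:
  "computes q xs a \<Longrightarrow> computes r xs b \<Longrightarrow> computes p [a, b] y \<Longrightarrow> computes (Comp p [q, r]) xs y"
  by (rule computes.comp[of _ _ "[a, b]"]) auto

definition add_prog :: program where
  "add_prog = Prec (Proj 0) (Comp Succ [Proj 1])"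

lemma computes_add: "computes add_prog [m, n] (m + n)"
  unfolding add_prog_def
proof (induction m)
  case (Suc m)
  show ?case
    by (rule computes.prec_Suc[OF Suc.IH])
      (use computes_Comp1[OF computes_Proj computes.succ, of 1 "[m, m + n, n]" "m + n"] in simp)
qed (auto intro!: computes.prec_0 computes_Proj)

definition pred_prog :: program where
  "pred_prog = Prec Zero (Proj 0)"

lemma computes_pred: "computes pred_prog [m] (m - 1)"
  unfolding pred_prog_def
proof (induction m)
  case (Suc m)
  show ?case
    by (rule computes.prec_Suc[OF Suc.IH]) (auto intro: computes_Proj)
qed (auto intro!: computes.prec_0 computes.zero)

definition monus_prog :: program where
  "monus_prog = Comp (Prec (Proj 0) (Comp pred_prog [Proj 1])) [Proj 1, Proj 0]"

lemma computes_monus: "computes monus_prog [m, n] (m - n)"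
proof -
  have "computes (Prec (Proj 0) (Comp pred_prog [Proj 1])) [n, m] (m - n)"
  proof (induction n)
    case (Suc n)
    show ?case
      by (rule computes.prec_Suc[OF Suc.IH])
        (use computes_Comp1[OF computes_Proj computes_pred, of 1 "[n, m - n, m]" "m - n"] in simp)
  qed (auto intro!: computes.prec_0 computes_Proj)
  then show ?thesis
    unfolding monus_prog_def
    by (rule computes_Comp2[OF computes_Proj computes_Proj, rotated 4]) simp_all
qed

definition triangle_prog :: program where
  "triangle_prog = Prec Zero (Comp Succ [Comp add_prog [Proj 1, Proj 0]])"

lemma computes_triangle: "computes triangle_prog [n] (triangle n)"
  unfolding triangle_prog_def
proof (induction n)
  case (Suc n)
  show ?case
    by (rule computes.prec_Suc[OF Suc.IH])
      (simp, intro computes_Comp1[OF _ computes.succ] computes_Comp2[OF _ _ computes_add];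
        simp add: computes_Proj)
qed (auto intro!: computes.prec_0 computes.zero)

definition pair_prog :: program where
  "pair_prog = Comp add_prog [Comp triangle_prog [add_prog], Proj 0]"

lemma computes_pair: "computes pair_prog [m, n] (prod_encode (m, n))"
  unfolding pair_prog_def prod_encode_def prod.case
  by (intro computes_Comp2[OF _ _ computes_add] computes_Comp1[OF _ computes_triangle]
    computes_add computes_Proj) simp_all

text \<open>
  The index of the largest triangular number below \<open>n\<close>, written as a primitive recursion; it is
  \<open>a + b\<close> if \<open>n\<close> is the code of the pair \<open>(a, b)\<close>.
\<close>

primrec triangle_root :: "nat \<Rightarrow> nat" where
  "triangle_root 0 = 0"
| "triangle_root (Suc n) =
     triangle_root n + (1 - (triangle (Suc (triangle_root n)) - Suc n))"

definition triangle_root_prog :: program where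
  "triangle_root_prog = Prec Zero (Comp add_prog [Proj 1, Comp monus_prog [Comp Succ [Zero],
     Comp monus_prog [Comp triangle_prog [Comp Succ [Proj 1]], Comp Succ [Proj 0]]]])"

lemma computes_triangle_root: "computes triangle_root_prog [n] (triangle_root n)"
  unfolding triangle_root_prog_def
proof (induction n)
  case (Suc n)
  define r where "r = triangle_root n"
  have "computes (Comp add_prog [Proj 1, Comp monus_prog [Comp Succ [Zero],
     Comp monus_prog [Comp triangle_prog [Comp Succ [Proj 1]], Comp Succ [Proj 0]]]])
     [n, r] (r + (Suc 0 - (triangle (Suc r) - Suc n)))"
    by (rule computes_Comp2[OF _ _ computes_add] computes_Comp2[OF _ _ computes_monus]
        computes_Comp1[OF _ computes_triangle] computes_Comp1[OF _ computes.succ]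
        computes.zero computes_Proj | simp)+
  with Suc.IH show ?case
    by (auto simp: r_def simp del: triangle_Suc intro: computes.prec_Suc)
qed (auto intro!: computes.prec_0 computes.zero)

lemma mono_triangle: "mono triangle"
  by (simp add: mono_iff_le_Suc)

lemma triangle_root_bounds:
  "triangle (triangle_root n) \<le> n \<and> n < triangle (Suc (triangle_root n))"
proof (induction n)
  case (Suc n)
  define r where "r = triangle_root n"
  show ?case
  proof (cases "triangle (Suc r) \<le> Suc n")
    case True
    then have "triangle_root (Suc n) = Suc r" "triangle (Suc r) = Suc n"
      using Suc by (simp_all add: r_def)
    then show ?thesis
      by simp
  next
    case False
    then have "triangle_root (Suc n) = r"
      unfolding triangle_root.simps r_def[symmetric] by linarith
    with Suc False show ?thesis
      unfolding r_def[symmetric] by (simp only:) linarith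
  qed
qed simp

lemma triangle_root_prod_encode: "triangle_root (prod_encode (m, n)) = m + n"
proof -
  define z where "z = prod_encode (m, n)"
  have z: "triangle (m + n) \<le> z" "z < triangle (Suc (m + n))"
    by (simp_all add: z_def prod_encode_def)
  note b = triangle_root_bounds[of z]
  have "triangle_root z < Suc (m + n)"
    using monoD[OF mono_triangle, of "Suc (m + n)" "triangle_root z"] z b by linarith
  moreover have "m + n < Suc (triangle_root z)"
    using monoD[OF mono_triangle, of "Suc (triangle_root z)" "m + n"] z b by linarith
  ultimately show ?thesis
    by (simp add: z_def)
qed

definition fst_prog :: program where
  "fst_prog = Comp monus_prog [Proj 0, Comp triangle_prog [triangle_root_prog]]"

lemma computes_fst: "computes fst_prog [prod_encode (m, n)] m"
proof -
  have "computes fst_prog [prod_encode (m, n)] (prod_encode (m, n) - triangle (m + n))"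
    unfolding fst_prog_def
    using computes_triangle_root[of "prod_encode (m, n)"] 
    by (auto intro!: computes_Comp2[OF _ _ computes_monus] computes_Comp1[OF _ computes_triangle]
        computes_Proj simp: triangle_root_prod_encode)
  then show ?thesis
    by (simp add: prod_encode_def)
qed

definition snd_prog :: program where
  "snd_prog = Comp monus_prog [triangle_root_prog, fst_prog]"

lemma computes_snd: "computes snd_prog [prod_encode (m, n)] n"
proof -
  have "computes snd_prog [prod_encode (m, n)] ((m + n) - m)"
    unfolding snd_prog_def
    using computes_Comp2[OF computes_triangle_root computes_fst computes_monus]
    by (simp only: triangle_root_prod_encode)
  then show ?thesis
    by simp
qed

subsection \<open>Closure properties\<close>

definition computable :: "('a::encodable \<Rightarrow> 'b::encodable) \<Rightarrow> bool" where
  "computable f \<longleftrightarrow> (\<exists>p. \<forall>x. computes p [encode x] (encode (f x)))"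

named_theorems computable_intros

lemma computableI: "(\<And>x. computes p [encode x] (encode (f x))) \<Longrightarrow> computable f"
  unfolding computable_def by blast

lemma computableE:
  assumes "computable f"
  obtains p where "\<And>x. computes p [encode x] (encode (f x))"
  using assms unfolding computable_def by blast

lemma computable_same_code: "(\<And>x. encode (f x) = encode x) \<Longrightarrow> computable f"
  by (rule computableI[of "Proj 0"]) (auto intro: computes_Proj)

lemma computable_id [computable_intros]: "computable (\<lambda>x. x)"
  by (rule computable_same_code) simp

lemma computable_compose:
  assumes "computable f" "computable g"
  shows "computable (\<lambda>x. f (g x))"
proof -
  obtain p q where "\<And>x. computes p [encode x] (encode (f x))" "\<And>x. computes q [encode x] (encode (g x))"
    using assms by (auto elim!: computableE)
  then show ?thesis
    by (intro computableI[of "Comp p [q]"] computes_Comp1)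
qed

lemma computable_const [computable_intros]: "computable (\<lambda>x. c)"
proof -
  have "\<exists>p. \<forall>xs. computes p xs n" for n
  proof (induction n)
    case (Suc n)
    then show ?case
      by (meson computes.succ computes_Comp1)
  qed (blast intro: computes.zero)
  then show ?thesis
    unfolding computable_def by blast
qed

lemma computable_Pair [computable_intros]:
  assumes "computable f" "computable g"
  shows "computable (\<lambda>x. (f x, g x))"
proof -
  obtain p q where "\<And>x. computes p [encode x] (encode (f x))" "\<And>x. computes q [encode x] (encode (g x))"
    using assms by (auto elim!: computableE)
  then show ?thesis
    by (intro computableI[of "Comp pair_prog [p, q]"])
      (auto simp: encode_Pair intro: computes_Comp2 computes_pair)
qed

lemma computable_fst [computable_intros]:
  assumes "computable f"
  shows "computable (\<lambda>x. fst (f x))"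
proof -
  have "computable (fst :: 'b \<times> 'c \<Rightarrow> 'b)"
    by (rule computableI[of fst_prog]) (auto simp: encode_Pair computes_fst)
  from computable_compose[OF this assms] show ?thesis .
qed

lemma computable_snd [computable_intros]:
  assumes "computable f"
  shows "computable (\<lambda>x. snd (f x))"
proof -
  have "computable (snd :: 'b \<times> 'c \<Rightarrow> 'c)"
    by (rule computableI[of snd_prog]) (auto simp: encode_Pair computes_snd)
  from computable_compose[OF this assms] show ?thesis .
qed

lemma computable_binary:
  assumes p: "\<And>a b. computes p [encode a, encode b] (encode (F a b))"
    and "computable f" "computable g"
  shows "computable (\<lambda>x. F (f x) (g x))"
proof -
  obtain q r where "\<And>x. computes q [encode x] (encode (f x))" "\<And>x. computes r [encode x] (encode (g x))"
    using assms(2,3) by (auto elim!: computableE)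
  then show ?thesis
    by (intro computableI[of "Comp p [q, r]"] computes_Comp2[OF _ _ p])
qed

lemma computable_add:
  assumes "computable f" "computable g"
  shows "computable (\<lambda>x. f x + g x :: nat)"
  by (rule computable_binary[of add_prog, OF _ assms]) (simp add: computes_add)

lemma computable_diff:
  assumes "computable f" "computable g"
  shows "computable (\<lambda>x. f x - g x :: nat)"
  by (rule computable_binary[of monus_prog, OF _ assms]) (simp add: computes_monus)

lemma computable_Suc_code:
  assumes "\<And>x. encode (f x) = Suc (encode x)"
  shows "computable f"
  using assms by (intro computableI[of Succ]) (simp add: computes.succ)

lemma computable_Some [computable_intros]:
  assumes "computable f"
  shows "computable (\<lambda>x. Some (f x))"
  using computable_compose[OF computable_Suc_code[of Some] assms] by (simp add: encode_Some)

lemma computable_Cons [computable_intros]: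
  assumes "computable f" "computable g"
  shows "computable (\<lambda>x. f x # g x)"
  using computable_compose[OF computable_Suc_code[of "\<lambda>(a, l). a # l"] computable_Pair[OF assms]]
  by (simp add: encode_Cons split_def)

text \<open>
  The programs have no case distinction; a primitive recursion on the code that ignores its
  recursive value takes the place of one.
\<close>

lemma computable_case_option [computable_intros]:
  assumes f: "computable f" and g: "computable g" and h: "computable (\<lambda>y. h (fst y) (snd y))"
  shows "computable (\<lambda>x. case f x of None \<Rightarrow> g x | Some a \<Rightarrow> h x a)"
proof -
  obtain p where p: "\<And>x. computes p [encode x] (encode (f x))"
    using f by (auto elim!: computableE)
  obtain q where q: "\<And>x. computes q [encode x] (encode (g x))"
    using g by (auto elim!: computableE)
  obtain r where r: "\<And>y. computes r [encode y] (encode (h (fst y) (snd y)))"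
    using h by (auto elim!: computableE)
  define c where "c = Prec q (Comp r [Comp pair_prog [Proj 2, Proj 0]])"
  have "computes c [k, encode x] (encode (case decode k of None \<Rightarrow> g x | Some a \<Rightarrow> h x a))" for k x
  proof (induction k)
    case 0
    have "decode 0 = (None :: 'b option)"
      by (metis encode_None decode_encode)
    then show ?case
      using q by (auto simp: c_def intro: computes.prec_0)
  next
    case (Suc k)
    \<comment> \<open>The recursive value is discarded but has to exist; it does because smaller codes are codes, too.\<close>
    have "decode (Suc k) = Some (decode k :: 'b)"
      by (metis encode_Some decode_encode encode_decode)
    moreover have "computes (Comp r [Comp pair_prog [Proj 2, Proj 0]]) [k, y, encode x]
        (encode (h x (decode k)))" for y
      using r[of "(x, decode k)"] computes_pair[of "encode x" k]
      by (auto simp: encode_Pair intro!: computes_Comp1 computes_Comp2 computes_Proj)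
    ultimately show ?case
      using Suc.IH unfolding c_def by (auto intro: computes.prec_Suc)
  qed
  from this[of "encode (f x)" x for x] show ?thesis
    using p by (intro computableI[of "Comp c [p, Proj 0]"]) (auto intro!: computes_Comp2 computes_Proj)
qed

lemma computable_case_list [computable_intros]:
  assumes f: "computable f" and g: "computable g"
    and h: "computable (\<lambda>y. h (fst y) (fst (snd y)) (snd (snd y)))"
  shows "computable (\<lambda>x. case f x of [] \<Rightarrow> g x | a # l \<Rightarrow> h x a l)"
proof -
  have "computable (\<lambda>l :: 'b list. case l of [] \<Rightarrow> None | a # l' \<Rightarrow> Some (a, l'))"
    by (rule computable_same_code) (simp add: encode_Cons encode_Some split: list.split)
  from computable_compose[OF this f]
  have "computable (\<lambda>x. case case f x of [] \<Rightarrow> None | a # l' \<Rightarrow> Some (a, l') of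
      None \<Rightarrow> g x | Some b \<Rightarrow> h x (fst b) (snd b))"
    by (intro computable_case_option g h)
  moreover have "(case case f x of [] \<Rightarrow> None | a # l' \<Rightarrow> Some (a, l') of
      None \<Rightarrow> g x | Some b \<Rightarrow> h x (fst b) (snd b)) =
    (case f x of [] \<Rightarrow> g x | a # l \<Rightarrow> h x a l)" for x
    by (simp split: list.split)
  ultimately show ?thesis
    by simp
qed

lemma computable_funpow:
  fixes g :: "'s::encodable \<Rightarrow> 's"
  assumes g: "computable g" and k: "computable k" and f: "computable f"
  shows "computable (\<lambda>x. (g ^^ k x) (f x))"
proof -
  obtain p where p: "\<And>x. computes p [encode x] (encode (g x))"
    using g by (auto elim!: computableE)
  have "computes (Prec (Proj 0) (Comp p [Proj 1])) [encode n, encode x] (encode ((g ^^ n) x))" for n x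
  proof (simp, induction n)
    case (Suc n)
    have "computes (Comp p [Proj 1]) [n, encode ((g ^^ n) x), encode x] (encode (g ((g ^^ n) x)))"
      by (rule computes_Comp1[OF _ p]) (simp add: computes_Proj)
    then show ?case
      using computes.prec_Suc[OF Suc.IH] by simp
  qed (auto intro!: computes.prec_0 computes_Proj)
  from computable_binary[OF this k f] show ?thesis .
qed

text \<open>
  A loop over a list is the iteration of one step on triples of the parameters, the accumulator and
  the rest of the list. Surplus rounds do no harm because the empty rest is a fixed point.
\<close>

lemma computable_foldl [computable_intros]:
  assumes f: "computable (\<lambda>y. f (fst y) (fst (snd y)) (snd (snd y)))"
    and s: "computable s" and l: "computable l"
  shows "computable (\<lambda>x. foldl (f x) (s x) (l x))"
proof -
  define g where "g z = (case snd (snd z) of [] \<Rightarrow> z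
    | a # l' \<Rightarrow> (fst z, f (fst z) (fst (snd z)) a, l'))" for z :: "'a \<times> 'b \<times> 'c list"
  have "computable (\<lambda>y :: ('a \<times> 'b \<times> 'c list) \<times> 'c \<times> 'c list.
      (fst (fst y), fst (snd (fst y)), fst (snd y)))"
    by (intro computable_intros)
  from computable_compose[OF f this]
  have fg: "computable (\<lambda>y :: ('a \<times> 'b \<times> 'c list) \<times> 'c \<times> 'c list.
      f (fst (fst y)) (fst (snd (fst y))) (fst (snd y)))"
    by simp
  have "computable g"
    unfolding g_def by (intro computable_intros fg)
  moreover have "computable (\<lambda>x. encode (l x))"
    using computable_compose[OF computable_same_code[of "encode :: 'c list \<Rightarrow> nat"] l] by simp
  moreover have "computable (\<lambda>x. (x, s x, l x))"
    by (intro computable_intros s l)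
  ultimately have "computable (\<lambda>x. fst (snd ((g ^^ encode (l x)) (x, s x, l x))))"
    by (intro computable_fst computable_snd computable_funpow)
  moreover have "(g ^^ k) (x, b, l') = (x, foldl (f x) b l', [])" if "length l' \<le> k" for k x b l'
    using that
  proof (induction k arbitrary: b l')
    case (Suc k)
    have step: "g (x, b, []) = (x, b, [])" "g (x, b, a # l) = (x, f x b a, l)" for a l
      by (simp_all add: g_def)
    show ?case
      using Suc.IH[of l' b] Suc.IH[of "tl l'" "f x b (hd l')"] Suc.prems
      by (cases l') (simp_all add: step funpow_Suc_right del: funpow.simps)
  qed simp
  ultimately show ?thesis
    by (simp add: length_le_encode)
qed

lemma computable_rev [computable_intros]:
  assumes "computable l"
  shows "computable (\<lambda>x. rev (l x))"
proof -
  have "rev (l x) = foldl (\<lambda>s a. a # s) [] (l x)" for x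
    by (simp add: foldl_conv_fold fold_Cons_rev)
  then show ?thesis
    by (simp only:) (intro computable_intros assms)
qed

lemma computable_foldr [computable_intros]:
  assumes f: "computable (\<lambda>y. f (fst y) (fst (snd y)) (snd (snd y)))"
    and s: "computable s" and l: "computable l"
  shows "computable (\<lambda>x. foldr (f x) (l x) (s x))"
proof -
  have "computable (\<lambda>y. (fst y, snd (snd y), fst (snd y)))"
    by (intro computable_intros)
  from computable_compose[OF f this] show ?thesis
    unfolding foldr_conv_foldl
    by (intro computable_foldl computable_rev l s) simp
qed

lemma computable_append [computable_intros]:
  assumes "computable f" "computable g"
  shows "computable (\<lambda>x. f x @ g x)"
proof -
  have "f x @ g x = foldr (\<lambda>a l. a # l) (f x) (g x)" for x
    by (simp add: foldr_conv_fold fold_Cons_rev)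
  then show ?thesis
    by (simp only:) (intro computable_intros assms)
qed

lemma computable_map [computable_intros]:
  assumes f: "computable (\<lambda>y. f (fst y) (snd y))" and l: "computable l"
  shows "computable (\<lambda>x. map (f x) (l x))"
proof -
  have "computable (\<lambda>y. (fst y, fst (snd y)))"
    by (intro computable_intros)
  from computable_compose[OF f this]
  have "computable (\<lambda>y. f (fst y) (fst (snd y)))"
    by simp
  then have "computable (\<lambda>x. foldr (\<lambda>a l. f x a # l) (l x) [])"
    by (intro computable_intros l)
  moreover have "foldr (\<lambda>a l. f x a # l) l' [] = map (f x) l'" for x l'
    by (induction l') simp_all
  ultimately show ?thesis
    by simp
qed

section \<open>Decidable and semidecidable predicates\<close>

text \<open>
  The closure rules below are stated for predicates applied to functions of a single variable that
  holds all parameters; bound variables are paired to it and read off with \<^const>\<open>fst\<close> and \<^const>\<open>snd\<close>.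
\<close>

definition decidable :: "('a::encodable \<Rightarrow> bool) \<Rightarrow> bool" where
  "decidable P \<longleftrightarrow> computable (\<lambda>x. if P x then 1 else 0 :: nat)"

named_theorems decidable_intros

lemma decidable_compose: "decidable P \<Longrightarrow> computable f \<Longrightarrow> decidable (\<lambda>x. P (f x))"
  unfolding decidable_def by (rule computable_compose)

lemma computable_If [computable_intros]:
  assumes "decidable P" "computable f" "computable g"
  shows "computable (\<lambda>x. if P x then f x else g x)"
proof -
  define nat_option where "nat_option n = (case n of 0 \<Rightarrow> None | Suc k \<Rightarrow> Some k)" for n
  have "computable nat_option"
    by (rule computable_same_code) (simp add: nat_option_def encode_Some split: nat.split)
  from computable_compose[OF this assms(1)[unfolded decidable_def]]
  have "computable (\<lambda>x. case nat_option (if P x then 1 else 0) of None \<Rightarrow> g x | Some _ \<Rightarrow> f x)"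
    by (intro computable_intros assms(3) computable_compose[OF assms(2)])
  moreover have "(case nat_option (if P x then 1 else 0) of None \<Rightarrow> g x | Some _ \<Rightarrow> f x)
      = (if P x then f x else g x)" for x
    by (simp add: nat_option_def)
  ultimately show ?thesis
    by simp
qed

lemma decidable_const [decidable_intros]: "decidable (\<lambda>x. c)"
  unfolding decidable_def by (rule computable_const)

lemma decidable_eq [decidable_intros]:
  assumes "computable f" "computable g"
  shows "decidable (\<lambda>x. f x = g x)"
proof -
  have c: "computable (\<lambda>x. encode (h x))" if "computable h" for h :: "'a \<Rightarrow> 'b"
    using computable_compose[OF computable_same_code[of "encode :: 'b \<Rightarrow> nat"] that] by simp
  have "computable (\<lambda>x. 1 - ((encode (f x) - encode (g x)) + (encode (g x) - encode (f x))))"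
    by (intro computable_diff computable_add computable_const c assms)
  moreover have "1 - ((encode (f x) - encode (g x)) + (encode (g x) - encode (f x)))
      = (if f x = g x then 1 else 0)" for x
  proof (cases "f x = g x")
    case False
    then have "encode (f x) \<noteq> encode (g x)"
      by simp
    with False show ?thesis
      by (simp del: encode_eq_iff)
  qed simp
  ultimately show ?thesis
    by (simp add: decidable_def)
qed

lemma decidable_If:
  assumes "decidable P" "decidable Q" "decidable R"
  shows "decidable (\<lambda>x. if P x then Q x else R x)"
proof -
  have "(if if P x then Q x else R x then 1 else 0 :: nat)
    = (if P x then if Q x then 1 else 0 else if R x then 1 else 0)" for x
    by simp
  then show ?thesis
    unfolding decidable_def by (simp only:) (intro computable_intros assms assms[unfolded decidable_def])
qed

lemma decidable_not [decidable_intros]: "decidable P \<Longrightarrow> decidable (\<lambda>x. \<not> P x)"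
  using decidable_If[of P "\<lambda>_. False" "\<lambda>_. True"] by (simp add: decidable_const if_bool_eq_disj)

lemma decidable_conj [decidable_intros]:
  "decidable P \<Longrightarrow> decidable Q \<Longrightarrow> decidable (\<lambda>x. P x \<and> Q x)"
  using decidable_If[of P Q "\<lambda>_. False"] by (simp add: decidable_const if_bool_eq_disj)

lemma decidable_disj [decidable_intros]:
  "decidable P \<Longrightarrow> decidable Q \<Longrightarrow> decidable (\<lambda>x. P x \<or> Q x)"
  using decidable_If[of P "\<lambda>_. True" Q] by (simp add: decidable_const if_bool_eq_conj disj_imp)

lemma decidable_imp [decidable_intros]:
  "decidable P \<Longrightarrow> decidable Q \<Longrightarrow> decidable (\<lambda>x. P x \<longrightarrow> Q x)"
  using decidable_If[of P Q "\<lambda>_. True"] by (simp add: decidable_const if_bool_eq_conj)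

lemma decidable_iff [decidable_intros]:
  "decidable P \<Longrightarrow> decidable Q \<Longrightarrow> decidable (\<lambda>x. P x \<longleftrightarrow> Q x)"
  unfolding iff_conv_conj_imp by (intro decidable_intros)

lemma decidable_Ball [decidable_intros]:
  assumes P: "decidable (\<lambda>y. P (fst y) (snd y))" and l: "computable l"
  shows "decidable (\<lambda>x. \<forall>a\<in>set (l x). P x a)"
proof -
  have "computable (\<lambda>y. (fst y, snd (snd y)))"
    by (intro computable_intros)
  from decidable_compose[OF P this] have "decidable (\<lambda>y. P (fst y) (snd (snd y)))"
    by simp
  then have "computable (\<lambda>x. foldl (\<lambda>s a. if P x a then s else 0) (1 :: nat) (l x))"
    by (intro computable_intros l)
  moreover have "foldl (\<lambda>s a. if P x a then s else 0) n l' = (if \<forall>a\<in>set l'. P x a then n else 0)"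
    for x l' and n :: nat
    by (induction l' arbitrary: n) auto
  ultimately show ?thesis
    by (simp add: decidable_def del: One_nat_def)
qed

lemma decidable_Bex [decidable_intros]:
  assumes "decidable (\<lambda>y. P (fst y) (snd y))" and "computable l"
  shows "decidable (\<lambda>x. \<exists>a\<in>set (l x). P x a)"
  using decidable_not[OF decidable_Ball[of "\<lambda>x a. \<not> P x a"]] assms by (simp add: decidable_not)

lemma decidable_member [decidable_intros]:
  assumes "computable f" "computable l"
  shows "decidable (\<lambda>x. f x \<in> set (l x))"
proof -
  have "decidable (\<lambda>x. \<exists>a\<in>set (l x). f x = a)"
    by (intro decidable_intros computable_intros assms computable_compose[OF assms(1)])
  then show ?thesis
    by simp
qed

definition semidecidable :: "('a::encodable \<Rightarrow> bool) \<Rightarrow> bool" where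
  "semidecidable P \<longleftrightarrow> (\<exists>T. decidable T \<and> (\<forall>x. P x \<longleftrightarrow> (\<exists>z :: nat. T (x, z))))"

named_theorems semidecidable_intros

text \<open>
  Witnesses can be taken from any encoded type instead of the natural numbers.
\<close>

lemma semidecidableI:
  fixes T :: "'a::encodable \<times> 'w::encodable \<Rightarrow> bool"
  assumes "decidable T" and "\<And>x. P x \<longleftrightarrow> (\<exists>z. T (x, z))"
  shows "semidecidable P"
proof -
  have "computable (\<lambda>y :: 'a \<times> nat. (fst y, decode (snd y) :: 'w))"
    by (intro computable_intros computable_compose[OF computable_same_code[of decode]]) simp
  from decidable_compose[OF assms(1) this]
  have "decidable (\<lambda>y :: 'a \<times> nat. T (fst y, decode (snd y)))" .
  moreover have "P x \<longleftrightarrow> (\<exists>z :: nat. T (x, decode z))" for x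
    unfolding assms(2) by (metis decode_encode)
  ultimately show ?thesis
    unfolding semidecidable_def by (intro exI[of _ "\<lambda>y. T (fst y, decode (snd y))"]) simp
qed

lemma semidecidableE:
  assumes "semidecidable P"
  obtains T where "decidable T" "\<And>x. P x \<longleftrightarrow> (\<exists>z :: nat. T (x, z))"
  using assms unfolding semidecidable_def by blast

lemma semidecidable_decidable: "decidable P \<Longrightarrow> semidecidable P"
  by (rule semidecidableI[of "\<lambda>y. P (fst y) \<and> snd y = (0 :: nat)"])
    (auto intro!: decidable_intros computable_intros intro: decidable_compose)

lemma semidecidable_compose:
  assumes "semidecidable P" "computable f"
  shows "semidecidable (\<lambda>x. P (f x))"
proof -
  obtain T where T: "decidable T" "\<And>x. P x \<longleftrightarrow> (\<exists>z :: nat. T (x, z))"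
    using assms(1) by (auto elim: semidecidableE)
  have "decidable (\<lambda>y :: 'b \<times> nat. T (f (fst y), snd y))"
    by (intro decidable_compose[OF T(1)] computable_intros computable_compose[OF assms(2)])
  then show ?thesis
    by (rule semidecidableI) (simp add: T(2))
qed

lemma semidecidable_conj [semidecidable_intros]:
  assumes "semidecidable P" "semidecidable Q"
  shows "semidecidable (\<lambda>x. P x \<and> Q x)"
proof -
  obtain T U where T: "decidable T" "\<And>x. P x \<longleftrightarrow> (\<exists>z :: nat. T (x, z))"
    and U: "decidable U" "\<And>x. Q x \<longleftrightarrow> (\<exists>z :: nat. U (x, z))"
    using assms by (auto elim!: semidecidableE)
  have "decidable (\<lambda>y :: 'a \<times> nat \<times> nat. T (fst y, fst (snd y)) \<and> U (fst y, snd (snd y)))"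
    by (intro decidable_intros decidable_compose[OF T(1)] decidable_compose[OF U(1)] computable_intros)
  then show ?thesis
    by (rule semidecidableI) (auto simp: T(2) U(2))
qed

lemma semidecidable_disj [semidecidable_intros]:
  assumes "semidecidable P" "semidecidable Q"
  shows "semidecidable (\<lambda>x. P x \<or> Q x)"
proof -
  obtain T U where T: "decidable T" "\<And>x. P x \<longleftrightarrow> (\<exists>z :: nat. T (x, z))"
    and U: "decidable U" "\<And>x. Q x \<longleftrightarrow> (\<exists>z :: nat. U (x, z))"
    using assms by (auto elim!: semidecidableE)
  have "decidable (\<lambda>y :: 'a \<times> nat. T y \<or> U y)"
    by (intro decidable_intros T U)
  then show ?thesis
    by (rule semidecidableI) (auto simp: T(2) U(2))
qed

lemma semidecidable_ex [semidecidable_intros]: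
  assumes "semidecidable (\<lambda>y. P (fst y) (snd y))"
  shows "semidecidable (\<lambda>x. \<exists>a. P x a)"
proof -
  obtain T where T: "decidable T" "\<And>y. P (fst y) (snd y) \<longleftrightarrow> (\<exists>z :: nat. T (y, z))"
    using assms by (auto elim!: semidecidableE)
  have "decidable (\<lambda>y. T ((fst y, fst (snd y)), snd (snd y)))"
    by (intro decidable_compose[OF T(1)] computable_intros)
  then show ?thesis
    by (rule semidecidableI) (use T(2)[of "(_, _)"] in auto)
qed

text \<open>
  A bounded universal quantifier needs one witness per list element; the witnesses are guessed
  together, as a second component attached to the elements.
\<close>

lemma semidecidable_Ball [semidecidable_intros]:
  assumes P: "semidecidable (\<lambda>y. P (fst y) (snd y))" and l: "computable l"
  shows "semidecidable (\<lambda>x. \<forall>a\<in>set (l x). P x a)"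
proof -
  obtain T where T: "decidable T" "\<And>y. P (fst y) (snd y) \<longleftrightarrow> (\<exists>z :: nat. T (y, z))"
    using P by (auto elim!: semidecidableE)
  have "decidable (\<lambda>y. map fst (snd y) = l (fst y) \<and>
      (\<forall>c\<in>set (snd y). T ((fst y, fst c), snd c)))"
    by (intro decidable_intros decidable_compose[OF T(1)] computable_intros
        computable_compose[OF l])
  then show ?thesis
  proof (rule semidecidableI)
    fix x
    show "(\<forall>a\<in>set (l x). P x a) \<longleftrightarrow> (\<exists>cs. map fst (snd (x, cs)) = l (fst (x, cs)) \<and>
      (\<forall>c\<in>set (snd (x, cs)). T ((fst (x, cs), fst c), snd c)))" (is "?L \<longleftrightarrow> ?R")
    proof
      assume ?L
      then have "\<forall>a\<in>set (l x). \<exists>z. T ((x, a), z)"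
        using T(2)[of "(x, _)"] by simp
      then obtain z where "\<And>a. a \<in> set (l x) \<Longrightarrow> T ((x, a), z a)"
        by metis
      then show ?R
        by (intro exI[of _ "map (\<lambda>a. (a, z a)) (l x)"]) (auto simp: o_def)
    next
      assume ?R
      then show ?L
        using T(2)[of "(x, _)"] by (auto simp flip: list.set_map) (metis imageE list.set_map)
    qed
  qed
qed

lemma semidecidable_Bex [semidecidable_intros]:
  assumes P: "semidecidable (\<lambda>y. P (fst y) (snd y))" and l: "computable l"
  shows "semidecidable (\<lambda>x. \<exists>a\<in>set (l x). P x a)"
  unfolding Bex_def
  by (intro semidecidable_ex semidecidable_conj P semidecidable_decidable decidable_member
      computable_snd computable_fst computable_compose[OF l] computable_id)

subsection \<open>Labelled paths\<close>

primrec labelled_path :: "('s \<Rightarrow> 'l \<Rightarrow> 's \<Rightarrow> bool) \<Rightarrow> 's \<Rightarrow> 'l list \<Rightarrow> 's \<Rightarrow> bool" where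
  "labelled_path R s [] t \<longleftrightarrow> s = t"
| "labelled_path R s (a # w) t \<longleftrightarrow> (\<exists>u. R s a u \<and> labelled_path R u w t)"

lemma labelled_path_append:
  "labelled_path R s (v @ w) t \<longleftrightarrow> (\<exists>u. labelled_path R s v u \<and> labelled_path R u w t)"
  by (induction v arbitrary: s) auto

text \<open>
  The witness for a path is the list of pairs of a remaining label and a current vertex; such a
  list is checked entry by entry, and a list that passes need not be in the order of the path.
\<close>

lemma semidecidable_labelled_path:
  fixes R :: "'p::encodable \<Rightarrow> 's::encodable \<Rightarrow> 'l::encodable \<Rightarrow> 's \<Rightarrow> bool"
  assumes R: "semidecidable (\<lambda>y. R (fst y) (fst (snd y)) (fst (snd (snd y))) (snd (snd (snd y))))"
    and p: "computable p" and s: "computable s" and w: "computable w" and t: "computable t"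
  shows "semidecidable (\<lambda>x. labelled_path (R (p x)) (s x) (w x) (t x))"
proof -
  have R': "semidecidable (\<lambda>x :: 'x::encodable. R (p x) (s x) (a x) (t x))"
    if "computable p" "computable s" "computable a" "computable t" for p s a t
    using semidecidable_compose[OF R, of "\<lambda>x. (p x, s x, a x, t x)"] that
    by (simp add: computable_intros)
  have "labelled_path (R p) s w t \<longleftrightarrow> (\<exists>C. (w, s) \<in> set C \<and>
      (\<forall>c\<in>set C. (fst c = [] \<and> snd c = t) \<or>
        (\<exists>a v u. fst c = a # v \<and> (v, u) \<in> set C \<and> R p (snd c) a u)))"
    (is "_ \<longleftrightarrow> (\<exists>C. _ \<and> ?ok C)") for p s w t
  proof
    assume "labelled_path (R p) s w t"
    then show "\<exists>C. (w, s) \<in> set C \<and> ?ok C"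
    proof (induction w arbitrary: s)
      case Nil
      then show ?case
        by (intro exI[of _ "[([], t)]"]) simp
    next
      case (Cons a w)
      then obtain u where u: "R p s a u" "labelled_path (R p) u w t"
        by auto
      from Cons.IH[OF u(2)] obtain C where "(w, u) \<in> set C" "?ok C"
        by blast
      with u(1) show ?case
        by (intro exI[of _ "(a # w, s) # C"]) auto
    qed
  next
    assume "\<exists>C. (w, s) \<in> set C \<and> ?ok C"
    then obtain C where C: "(w, s) \<in> set C" "?ok C"
      by blast
    from C(1) show "labelled_path (R p) s w t"
    proof (induction w arbitrary: s)
      case (Cons a w)
      then show ?case
        using C(2) by force
    qed (use C(2) in force)
  qed
  then show ?thesis
    by (simp only:) (intro semidecidable_intros;
      (rule R' | rule semidecidable_decidable)?; intro decidable_intros computable_intros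
      computable_compose[OF p] computable_compose[OF s] computable_compose[OF w]
      computable_compose[OF t])
qed

text \<open>
  A statement about all words over a fixed alphabet can be confirmed by a finite invariant, if only
  finitely many states are reachable.
\<close>

lemma semidecidable_all_words:
  assumes f: "computable (\<lambda>y. f (fst y) (fst (snd y)) (snd (snd y)))" and s: "computable s"
    and Q: "decidable (\<lambda>y. Q (fst y) (snd y))"
    and fin: "\<And>x. finite (foldl (f x) (s x) ` lists (set as))"
  shows "semidecidable (\<lambda>x. \<forall>w\<in>lists (set as). Q x (foldl (f x) (s x) w))"
proof -
  have "(\<forall>w\<in>lists (set as). Q x (foldl (f x) (s x) w)) \<longleftrightarrow>
    (\<exists>I. s x \<in> set I \<and> (\<forall>q\<in>set I. Q x q \<and> (\<forall>a\<in>set as. f x q a \<in> set I)))"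
    (is "?L \<longleftrightarrow> (\<exists>I. ?R I)") for x
  proof
    assume L: ?L
    obtain I where I: "set I = foldl (f x) (s x) ` lists (set as)"
      using finite_list[OF fin] by blast
    have "f x (foldl (f x) (s x) w) a \<in> set I" if "w \<in> lists (set as)" "a \<in> set as" for w a
    proof -
      have "w @ [a] \<in> lists (set as)"
        using that by simp
      then have "foldl (f x) (s x) (w @ [a]) \<in> set I"
        unfolding I by (rule imageI)
      then show ?thesis
        by simp
    qed
    moreover have "s x \<in> set I"
      unfolding I by (rule image_eqI[of _ _ "[]"]) simp_all
    ultimately have "?R I"
      using L I by auto
    then show "\<exists>I. ?R I" ..
  next
    assume "\<exists>I. ?R I"
    then obtain I where I: "?R I" ..
    have "foldl (f x) (s x) w \<in> set I" if "w \<in> lists (set as)" for w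
      using that by (induction w rule: rev_induct) (use I in auto)
    then show ?L
      using I by blast
  qed
  moreover have "computable (\<lambda>y. f (fst (fst (fst y))) (snd (fst y)) (snd y))"
    using computable_compose[OF f, of "\<lambda>y. (fst (fst (fst y)), snd (fst y), snd y)"]
    by (simp add: computable_intros)
  moreover have "decidable (\<lambda>y. Q (fst (fst y)) (snd y))"
    using decidable_compose[OF Q, of "\<lambda>y. (fst (fst y), snd y)"] by (simp add: computable_intros)
  ultimately show ?thesis
    by (simp only:) (rule semidecidable_ex, rule semidecidable_decidable,
      intro decidable_intros computable_intros computable_compose[OF s])
qed

subsection \<open>Search\<close>

lemma computes_Comp1_iff: "computes (Comp p [q]) xs y \<longleftrightarrow> (\<exists>a. computes q xs a \<and> computes p [a] y)"
  by (auto intro: computes_Comp1 elim!: computes.cases[of "Comp p [q]"] simp: list_all2_Cons1)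

text \<open>
  One number codes a candidate \<open>b\<close> and a witness for it. The program finds the least number that
  passes the decidable test and returns its first half. The test is total, so the search gets past
  every failing number.
\<close>

lemma semidecidable_search:
  fixes P :: "'a::encodable \<times> 'b::encodable \<Rightarrow> bool"
  assumes "semidecidable P"
  obtains p where "\<And>x y. computes p [encode x] y \<Longrightarrow> \<exists>b. y = encode b \<and> P (x, b)"
    and "\<And>x b. P (x, b) \<Longrightarrow> \<not> runs_forever p [encode x]"
proof -
  obtain T where T: "decidable T" "\<And>y. P y \<longleftrightarrow> (\<exists>z :: nat. T (y, z))"
    using assms by (auto elim!: semidecidableE)
  have "computable (\<lambda>y :: ('b \<times> nat) \<times> 'a.
      if T ((snd y, fst (fst y)), snd (fst y)) then 0 else Suc 0)"
    by (intro computable_intros decidable_compose[OF T(1)])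
  then obtain q where "\<And>y :: ('b \<times> nat) \<times> 'a. computes q [encode y]
      (encode (if T ((snd y, fst (fst y)), snd (fst y)) then 0 else Suc 0))"
    unfolding computable_def by blast
  then have q: "computes q [encode y] (if T ((snd y, fst (fst y)), snd (fst y)) then 0 else Suc 0)"
    for y :: "('b \<times> nat) \<times> 'a"
    by simp
  define ok where "ok k x \<longleftrightarrow> T ((x, fst (decode k :: 'b \<times> nat)), snd (decode k :: 'b \<times> nat))" for k x
  define r where "r = Comp q [pair_prog]"
  have r: "computes r [k, encode x]
      (if ok k x then 0 else Suc 0)" for k x
    unfolding r_def ok_def using q[of "(decode k, x)"]
    by (intro computes_Comp1[OF computes_pair]) (simp only: encode_Pair encode_decode fst_conv snd_conv)
  have fst: "computes fst_prog [k] (encode (fst (decode k :: 'b \<times> nat)))" for k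
    using computes_fst[of "encode (fst (decode k :: 'b \<times> nat))" "snd (decode k :: 'b \<times> nat)"]
      encode_Pair[of "fst (decode k :: 'b \<times> nat)" "snd (decode k :: 'b \<times> nat)"] by simp
  show ?thesis
  proof (rule that[of "Comp fst_prog [Mu r]"])
    fix x :: 'a and y
    assume "computes (Comp fst_prog [Mu r]) [encode x] y"
    then obtain k where k: "computes (Mu r) [encode x] k" "computes fst_prog [k] y"
      by (auto simp: computes_Comp1_iff)
    from k(1) have "computes r [k, encode x] 0"
      by cases simp_all
    from computes_deterministic[OF this r] have "ok k x"
      by (simp split: if_splits)
    moreover have "y = encode (fst (decode k :: 'b \<times> nat))"
      using computes_deterministic[OF fst k(2)] .
    ultimately show "\<exists>b. y = encode b \<and> P (x, b)"
      using T(2) unfolding ok_def by blast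
  next
    fix x b
    assume "P (x, b)"
    then obtain z where "T ((x, b), z)"
      using T(2) by blast
    then have "\<exists>k. ok k x"
      unfolding ok_def by (intro exI[of _ "encode (b, z)"]) simp
    define k where "k = (LEAST k. ok k x)"
    have "ok k x"
      unfolding k_def by (rule LeastI_ex) fact
    then have "computes r [k, encode x] 0"
      using r[of k x] by simp
    moreover have "\<exists>y. computes r [i, encode x] (Suc y)" if "i < k" for i
      using r[of i x] not_less_Least[of i "\<lambda>k. ok k x"] that
      by (auto simp: k_def)
    ultimately have "computes (Mu r) [encode x] k"
      by (rule computes.mu)
    then show "\<not> runs_forever (Comp fst_prog [Mu r]) [encode x]"
      using fst unfolding runs_forever_def by (blast intro: computes_Comp1)
  qed
qed

section \<open>Regular languages\<close>

lemma fsa_run_append: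
  "fsa_run M q (v @ w) = (case fsa_run M q v of None \<Rightarrow> None | Some q' \<Rightarrow> fsa_run M q' w)"
  by (induction v arbitrary: q) (auto split: option.split)

lemma fsa_run_in_table:
  "fsa_run M q w = Some q' \<Longrightarrow> q' \<in> insert q (snd ` set (table M))"
  by (induction w arbitrary: q) (force dest: map_of_SomeD split: option.splits)+

lemma finite_range_fsa_run: "finite (range (fsa_run M q))"
proof (rule finite_subset)
  show "range (fsa_run M q) \<subseteq> insert None (Some ` insert q (snd ` set (table M)))"
    by (rule image_subsetI) (metis fsa_run_in_table image_eqI insertCI not_Some_eq)
qed simp

lemma fsa_run_in_lists: "fsa_over A M \<Longrightarrow> fsa_run M q w = Some q' \<Longrightarrow> w \<in> lists A"
  by (induction w arbitrary: q) (force simp: fsa_over_def dest: map_of_SomeD split: option.splits)+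

lemma fsa_lang_subset_lists: "fsa_over A M \<Longrightarrow> fsa_lang M \<subseteq> lists A"
  by (auto simp: fsa_lang_def dest: fsa_run_in_lists)

lemma fsa_lang_append_cong:
  "fsa_run M (initial M) v = fsa_run M (initial M) v' \<Longrightarrow> v @ w \<in> fsa_lang M \<longleftrightarrow> v' @ w \<in> fsa_lang M"
  by (simp add: fsa_lang_def fsa_run_append)

definition residual :: "'a list set \<Rightarrow> 'a list \<Rightarrow> 'a list set" where
  "residual K x = {y. x @ y \<in> K}"

lemma finite_range_factor:
  assumes "finite (range g)" "\<And>x y. g x = g y \<Longrightarrow> f x = f y"
  shows "finite (range f)"
proof (rule finite_subset)
  show "range f \<subseteq> (\<lambda>c. f (SOME x. g x = c)) ` range g"
  proof clarify
    fix x
    have "g (SOME y. g y = g x) = g x"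
      by (rule someI) simp
    from assms(2)[OF this] show "f x \<in> (\<lambda>c. f (SOME x. g x = c)) ` range g"
      by (metis rangeI image_eqI)
  qed
qed (use assms(1) in simp)

text \<open>
  One half of the Myhill-Nerode theorem: the state reached determines the residual.
\<close>

lemma finite_residuals_fsa_lang: "finite (range (residual (fsa_lang M)))"
  by (rule finite_range_factor[OF finite_range_fsa_run[of M "initial M"]])
    (unfold residual_def, rule Collect_cong, rule fsa_lang_append_cong)

text \<open>
  Every transition lies on an accepting run. The first conjunct excludes table entries that
  \<^const>\<open>map_of\<close> never reaches because an earlier one has the same key.
\<close>

definition trim_fsa :: "'a fsa \<Rightarrow> bool" where
  "trim_fsa N \<longleftrightarrow> (\<forall>((q, a), q') \<in> set (table N). map_of (table N) (q, a) = Some q' \<and>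
     (\<exists>w. fsa_run N (initial N) w = Some q) \<and>
     (\<exists>w. \<exists>q''\<in>set (accepting N). fsa_run N q' w = Some q''))"

text \<open>
  The other half of the Myhill-Nerode theorem: the states are the residuals. Leaving out the empty
  residual makes the automaton trim, because from a nonempty one an accepting state can be reached.
\<close>

lemma ex_trim_fsa:
  assumes "finite A" "K \<subseteq> lists A" and fin: "finite (range (residual K))"
  shows "\<exists>N. fsa_over A N \<and> fsa_lang N = K \<and> trim_fsa N"
proof -
  obtain idx :: "'a list set \<Rightarrow> nat" where idx: "inj_on idx (range (residual K))"
    using finite_imp_inj_to_nat_seg[OF fin] by blast
  define s where "s x = idx (residual K x)" for x
  have s_eq: "s x = s y \<longleftrightarrow> residual K x = residual K y" for x y
    using idx by (auto simp: s_def inj_on_def)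
  have s_snoc: "s x = s y \<Longrightarrow> residual K (x @ v) = residual K (y @ v)" for x y v
    unfolding s_eq by (auto simp: residual_def)
  \<comment> \<open>No transition into the empty residual; a missing entry rejects.\<close>
  define T where "T = {((s x, a), s (x @ [a])) | x a. residual K (x @ [a]) \<noteq> {}}"
  have letter: "a \<in> A" if "residual K (x @ [a]) \<noteq> {}" for x a
    using that assms(2) by (force simp: residual_def)
  have "finite (range s)"
    using fin by (simp add: s_def flip: image_image)
  moreover have "T \<subseteq> (range s \<times> A) \<times> range s"
    using letter by (auto simp: T_def)
  ultimately have "finite T"
    using \<open>finite A\<close> by (meson finite_SigmaI finite_subset)
  then obtain tab where tab: "set tab = T"
    using finite_list by blast
  obtain acc where acc: "set acc = s ` K"
    using finite_list[of "s ` K"] \<open>finite (range s)\<close> by (meson finite_subset subset_UNIV image_mono)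
  define N where "N = FSA (s []) tab acc"
  have T_iff: "((s x, a), r) \<in> T \<longleftrightarrow> residual K (x @ [a]) \<noteq> {} \<and> r = s (x @ [a])" for x a r
  proof
    assume "((s x, a), r) \<in> T"
    then obtain y where y: "s x = s y" "r = s (y @ [a])" "residual K (y @ [a]) \<noteq> {}"
      by (auto simp: T_def)
    then show "residual K (x @ [a]) \<noteq> {} \<and> r = s (x @ [a])"
      using s_snoc[OF y(1), of "[a]"] by (simp add: s_eq)
  qed (auto simp: T_def)
  have map: "map_of tab (s x, a) = (if residual K (x @ [a]) \<noteq> {} then Some (s (x @ [a])) else None)"
    for x a
  proof (cases "map_of tab (s x, a)")
    case None
    then have "((s x, a), r) \<notin> T" for r
      using tab by (auto simp: map_of_eq_None_iff image_iff)
    with None show ?thesis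
      using T_iff by auto
  next
    case (Some r)
    then have "((s x, a), r) \<in> T"
      using tab by (auto dest: map_of_SomeD)
    with Some show ?thesis
      using T_iff by simp
  qed
  have res_snoc: "residual K (x @ a # w) \<noteq> {} \<Longrightarrow> residual K (x @ [a]) \<noteq> {}" for x a w
    by (auto simp: residual_def)
  have run: "fsa_run N (s x) w =
      (if w = [] \<or> residual K (x @ w) \<noteq> {} then Some (s (x @ w)) else None)" for x w
  proof (induction w arbitrary: x)
    case (Cons a w)
    show ?case
      using Cons.IH[of "x @ [a]"] res_snoc[of x a w] map[of x a] by (auto simp: N_def)
  qed simp
  have nonempty: "residual K w \<noteq> {}" if "w \<in> K" for w
    using that by (auto simp: residual_def intro: exI[of _ "[]"])
  have "fsa_over A N"
    using letter by (auto simp: fsa_over_def N_def tab T_def)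
  moreover have "fsa_lang N = K"
  proof (intro Set.set_eqI iffI)
    fix w
    assume "w \<in> fsa_lang N"
    then obtain v where v: "v \<in> K" "fsa_run N (s []) w = Some (s v)"
      by (auto simp: fsa_lang_def N_def acc)
    then have "s v = s w"
      using run[of "[]" w] by (auto split: if_splits)
    then show "w \<in> K"
      using v(1) s_eq by (auto simp: residual_def dest: arg_cong[of _ _ "\<lambda>S. [] \<in> S"])
  next
    fix w
    assume "w \<in> K"
    then show "w \<in> fsa_lang N"
      using run[of "[]" w] nonempty by (auto simp: fsa_lang_def N_def acc)
  qed
  moreover have "trim_fsa N"
    unfolding trim_fsa_def
  proof (clarify)
    fix q a q'
    assume "((q, a), q') \<in> set (table N)"
    then obtain x where x: "q = s x" "q' = s (x @ [a])" "residual K (x @ [a]) \<noteq> {}"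
      by (auto simp: N_def tab T_def)
    then obtain y where y: "x @ [a] @ y \<in> K"
      by (auto simp: residual_def)
    have "residual K x \<noteq> {}"
      using y by (auto simp: residual_def)
    then have "fsa_run N (initial N) x = Some q"
      using run[of "[]" x] x(1) by (simp add: N_def)
    moreover have "fsa_run N q' y = Some (s (x @ [a] @ y))"
      using run[of "x @ [a]" y] x(2) nonempty[OF y] by simp
    moreover have "s (x @ [a] @ y) \<in> set (accepting N)"
      using y by (simp add: N_def acc)
    moreover have "map_of (table N) (q, a) = Some q'"
      using map[of x a] x by (simp add: N_def)
    ultimately show "map_of (table N) (q, a) = Some q' \<and> (\<exists>w. fsa_run N (initial N) w = Some q) \<and>
        (\<exists>w. \<exists>q''\<in>set (accepting N). fsa_run N q' w = Some q'')"
      by blast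
  qed
  ultimately show ?thesis
    by blast
qed

subsection \<open>Padded pairs\<close>

definition somes :: "'a option list \<Rightarrow> 'a list" where
  "somes xs = foldr (\<lambda>x l. case x of None \<Rightarrow> l | Some a \<Rightarrow> a # l) xs []"

lemma somes_simps [simp]:
  "somes [] = []" "somes (None # xs) = somes xs" "somes (Some a # xs) = a # somes xs"
  by (simp_all add: somes_def)

lemma somes_pad [simp]: "somes (map fst (pad w u)) = w" "somes (map snd (pad w u)) = u"
  by (induction w u rule: pad.induct) simp_all

lemma pad_inject [simp]: "pad w u = pad w' u' \<longleftrightarrow> w = w' \<and> u = u'"
  by (metis somes_pad)

lemma pad_append_right: "length u \<le> length x \<Longrightarrow> pad (x @ y) u = pad x u @ pad y []"
  by (induction x u rule: pad.induct) simp_all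

lemma pad_append: "length u = length x \<Longrightarrow> pad (x @ y) (u @ v) = pad x u @ pad y v"
  by (induction x u rule: pad.induct) simp_all

text \<open>
  Regular languages are closed under inverse images of regular relations. A residual of the inverse
  image by \<open>x\<close> is determined by the pairs of states of \<open>m\<close> and \<open>N\<close> that are reached with \<open>x\<close> on the
  first tape and some \<open>u\<close>, not longer than \<open>x\<close>, on the second one. The third component of \<open>f\<close> tells
  whether \<open>u\<close> is shorter, since then only padding may follow on the second tape.
\<close>

lemma finite_residuals_projection:
  assumes R: "fsa_lang m = {pad w u | w u. (w, u) \<in> R}"
    and K: "K = {w. \<exists>u\<in>fsa_lang N. (w, u) \<in> R}"
  shows "finite (range (residual K))"
proof -
  define f where "f x = {(fsa_run m (initial m) (pad x u), fsa_run N (initial N) u, length u < length x) | u.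
    length u \<le> length x}" for x
  have K': "w \<in> K \<longleftrightarrow> (\<exists>u\<in>fsa_lang N. pad w u \<in> fsa_lang m)" for w
    by (auto simp: R K)
  have le: "x' @ y \<in> K" if f: "f x = f x'" and y: "x @ y \<in> K" for x x' y
  proof -
    obtain u where u: "u \<in> fsa_lang N" "pad (x @ y) u \<in> fsa_lang m"
      using y K' by blast
    show ?thesis
    proof (cases "length u < length x")
      case True
      then have "(fsa_run m (initial m) (pad x u), fsa_run N (initial N) u, True) \<in> f x"
        unfolding f_def by fastforce
      then obtain u' where u': "length u' < length x'"
        "fsa_run m (initial m) (pad x u) = fsa_run m (initial m) (pad x' u')"
        "fsa_run N (initial N) u = fsa_run N (initial N) u'"
        unfolding f by (auto simp: f_def)
      have "u' \<in> fsa_lang N"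
        using fsa_lang_append_cong[OF u'(3), of "[]"] u(1) by simp
      moreover have "pad (x' @ y) u' \<in> fsa_lang m"
        using fsa_lang_append_cong[OF u'(2), of "pad y []"] u(2) u'(1) True
        by (simp add: pad_append_right)
      ultimately show ?thesis
        using K' by blast
    next
      case False
      define u1 u2 where "u1 = take (length x) u" and "u2 = drop (length x) u"
      have u12: "u = u1 @ u2" "length u1 = length x"
        using False by (simp_all add: u1_def u2_def)
      then have "(fsa_run m (initial m) (pad x u1), fsa_run N (initial N) u1, False) \<in> f x"
        unfolding f_def by fastforce
      then obtain u' where u': "length u' = length x'"
        "fsa_run m (initial m) (pad x u1) = fsa_run m (initial m) (pad x' u')"
        "fsa_run N (initial N) u1 = fsa_run N (initial N) u'"
        unfolding f by (auto simp: f_def)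
      have "u' @ u2 \<in> fsa_lang N"
        using fsa_lang_append_cong[OF u'(3), of u2] u(1) u12 by simp
      moreover have "pad (x' @ y) (u' @ u2) \<in> fsa_lang m"
        using fsa_lang_append_cong[OF u'(2), of "pad y u2"] u(2) u'(1) u12
        by (simp add: pad_append)
      ultimately show ?thesis
        using K' by blast
    qed
  qed
  have "range f \<subseteq> Pow (range (fsa_run m (initial m)) \<times> range (fsa_run N (initial N)) \<times> UNIV)"
    by (auto simp: f_def)
  then have "finite (range f)"
    by (rule finite_subset) (simp add: finite_range_fsa_run)
  then show ?thesis
  proof (rule finite_range_factor)
    show "residual K x = residual K y" if "f x = f y" for x y
      unfolding residual_def using le[OF that] le[OF that[symmetric]] by blast
  qed
qed

section \<open>Certificates\<close>

text \<open>
  In this section \<open>Ms\<close> lists the letters with their multiplier automata, \<open>Ps\<close> the padded alphabet, and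
  \<open>e\<close> is the representative of \<open>1\<close>. All conditions are phrased by automata and lists only, so that
  they can be searched for; their meaning in the group is the content of the lemmas that follow.

  The edges of this labelled graph on \<open>L\<close> are those of the Cayley graph (\<open>mult_edge_iff\<close>).
\<close>

definition mult_edge ::
    "('a \<times> ('a option \<times> 'a option) fsa) list \<Rightarrow> 'a list \<Rightarrow> 'a \<Rightarrow> 'a list \<Rightarrow> bool" where
  "mult_edge Ms w a u \<longleftrightarrow> (\<exists>am\<in>set Ms. fst am = a \<and>
     (\<exists>z. z \<in> fsa_lang (snd am) \<and> somes (map fst z) = w \<and> somes (map snd z) = u))"

text \<open>
  The languages of \<open>N\<close> and \<open>N'\<close> correspond under right multiplication by \<open>a\<close>. Because this is an
  equivalence, a loop with label \<open>v\<close> expresses the invariance under \<open>v\<close> and its inverse at once.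
\<close>

definition translate_edge ::
    "('a option \<times> 'a option) list \<Rightarrow> ('a \<times> ('a option \<times> 'a option) fsa) list \<Rightarrow>
     'a fsa \<Rightarrow> 'a \<Rightarrow> 'a fsa \<Rightarrow> bool" where
  "translate_edge Ps Ms N a N' \<longleftrightarrow> (\<exists>am\<in>set Ms. fst am = a \<and>
     (\<forall>z\<in>lists (set Ps). z \<in> fsa_lang (snd am) \<longrightarrow>
        (somes (map fst z) \<in> fsa_lang N \<longleftrightarrow> somes (map snd z) \<in> fsa_lang N')))"

text \<open>
  Right multiplication by a generator of \<open>H\<close> or its inverse. Inverses are obtained by walking
  backwards, which makes formal inverses of words unnecessary.
\<close>

definition generator_edge ::
    "('a \<times> ('a option \<times> 'a option) fsa) list \<Rightarrow> 'a list list \<Rightarrow> 'a list \<Rightarrow> 'a list \<Rightarrow> 'a list \<Rightarrow> bool"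
  where
  "generator_edge Ms vs w v u \<longleftrightarrow> v \<in> set vs \<and>
     (labelled_path (mult_edge Ms) w v u \<or> labelled_path (mult_edge Ms) u v w)"

text \<open>
  \<open>x \<in> H y\<close>, witnessed by a representative \<open>h\<close> of an element of \<open>H\<close> such that \<open>h y\<close> and \<open>x\<close> have the
  same representative \<open>w\<close>.
\<close>

definition same_coset ::
    "('a \<times> ('a option \<times> 'a option) fsa) list \<Rightarrow> 'a list \<Rightarrow> 'a list list \<Rightarrow> 'a list \<Rightarrow> 'a list \<Rightarrow> bool"
  where
  "same_coset Ms e vs x y \<longleftrightarrow> (\<exists>gs h w. labelled_path (generator_edge Ms vs) e gs h \<and>
     labelled_path (mult_edge Ms) h y w \<and> labelled_path (mult_edge Ms) e x w)"

text \<open>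
  An entry \<open>(q, c)\<close> of \<open>D\<close> stands for the claim that words leading to \<open>q\<close> lie in \<open>H c\<close>. The conditions
  make this claim true for the empty word, carry it along transitions, and turn it into membership
  in \<open>H\<close> at accepting states.
\<close>

definition coset_labelling ::
    "('a \<times> ('a option \<times> 'a option) fsa) list \<Rightarrow> 'a list \<Rightarrow> 'a list list \<Rightarrow> 'a fsa \<Rightarrow>
     (nat \<times> 'a list) list \<Rightarrow> bool" where
  "coset_labelling Ms e vs N D \<longleftrightarrow> (initial N, []) \<in> set D \<and>
     (\<forall>d\<in>set D.
       (\<forall>t\<in>set (table N). fst (fst t) \<noteq> fst d \<or>
          (\<exists>d'\<in>set D. fst d' = snd t \<and> same_coset Ms e vs (snd d @ [snd (fst t)]) (snd d'))) \<and>
       (fst d \<notin> set (accepting N) \<or> same_coset Ms e vs (snd d) []))"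

definition certified ::
    "'a list \<Rightarrow> ('a option \<times> 'a option) list \<Rightarrow> ('a \<times> ('a option \<times> 'a option) fsa) list \<Rightarrow>
     'a fsa \<Rightarrow> 'a list \<Rightarrow> 'a list list \<Rightarrow> 'a fsa \<Rightarrow> bool" where
  "certified As Ps Ms M e vs N \<longleftrightarrow>
     (\<forall>t\<in>set (table N). snd (fst t) \<in> set As) \<and>
     (\<forall>w\<in>lists (set As). w \<in> fsa_lang N \<longrightarrow> w \<in> fsa_lang M) \<and>
     e \<in> fsa_lang N \<and>
     (\<forall>v\<in>set vs. labelled_path (translate_edge Ps Ms) N v N) \<and>
     (\<exists>D. coset_labelling Ms e vs N D)"

locale automatic_group = group G for G (structure) +
  fixes \<mu> :: "'b \<Rightarrow> 'a" and M :: "'b fsa" and Meq m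
    and As :: "'b list" and Ps Ms and e :: "'b list"
  assumes gens: "\<mu> \<in> set As \<rightarrow> carrier G"
    and automatic: "automatic_structure_unique G (set As) \<mu> M Meq m"
    and Ps: "set Ps = pad_alphabet (set As)"
    and Ms: "set Ms = (\<lambda>a. (a, m a)) ` set As"
    and e: "e \<in> fsa_lang M" "word_val G \<mu> e = \<one>"
begin

abbreviation A :: "'b set" where "A \<equiv> set As"
abbreviation L :: "'b list set" where "L \<equiv> fsa_lang M"
abbreviation \<pi> :: "'b list \<Rightarrow> 'a" where "\<pi> \<equiv> word_val G \<mu>"

lemma word_val_simps [simp]: "\<pi> [] = \<one>" "\<pi> (a # w) = \<mu> a \<otimes> \<pi> w"
  by (simp_all add: word_val_def)

lemma word_val_closed [simp]: "w \<in> lists A \<Longrightarrow> \<pi> w \<in> carrier G"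
  using gens by (induction w) auto

lemma word_val_append:
  "v \<in> lists A \<Longrightarrow> w \<in> lists A \<Longrightarrow> \<pi> (v @ w) = \<pi> v \<otimes> \<pi> w"
proof (induction v)
  case (Cons a v)
  then have "\<mu> a \<in> carrier G"
    using gens by auto
  with Cons show ?case
    by (simp add: m_assoc)
qed simp

lemma L_lists: "w \<in> L \<Longrightarrow> w \<in> lists A"
  using automatic fsa_lang_subset_lists
  by (auto simp: automatic_structure_unique_def automatic_structure_def)

lemma L_closed [simp]: "w \<in> L \<Longrightarrow> \<pi> w \<in> carrier G"
  by (simp add: L_lists)

lemma representative: "g \<in> carrier G \<Longrightarrow> \<exists>w\<in>L. \<pi> w = g"
  using automatic by (auto simp: automatic_structure_unique_def)

lemma representative_unique: "w \<in> L \<Longrightarrow> u \<in> L \<Longrightarrow> \<pi> w = \<pi> u \<Longrightarrow> w = u"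
  using automatic L_closed unfolding automatic_structure_unique_def by metis

lemma multiplier:
  assumes "a \<in> A"
  shows "fsa_over (pad_alphabet A) (m a)"
    and "fsa_lang (m a) = {pad w u | w u. (w, u) \<in> {(w, u). w \<in> L \<and> u \<in> L \<and> \<pi> (w @ [a]) = \<pi> u}}"
  using automatic assms
  by (auto simp: automatic_structure_unique_def automatic_structure_def accepts_pairs_def)

lemma multiplier_iff:
  "a \<in> A \<Longrightarrow> z \<in> fsa_lang (m a) \<longleftrightarrow>
    (\<exists>w u. z = pad w u \<and> w \<in> L \<and> u \<in> L \<and> \<pi> w \<otimes> \<pi> [a] = \<pi> u)"
  using multiplier(2)[of a] L_lists by (auto simp: word_val_append simp del: word_val_simps) 

lemma mult_edge_iff:
  "mult_edge Ms w a u \<longleftrightarrow> a \<in> A \<and> w \<in> L \<and> u \<in> L \<and> \<pi> w \<otimes> \<pi> [a] = \<pi> u"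
proof -
  have "mult_edge Ms w a u \<longleftrightarrow> a \<in> A \<and> (\<exists>z. z \<in> fsa_lang (m a) \<and> somes (map fst z) = w \<and> somes (map snd z) = u)"
    by (auto simp: mult_edge_def Ms)
  then show ?thesis
    using multiplier_iff by (metis (no_types, lifting) somes_pad)
qed

lemma translate_edge_iff:
  "translate_edge Ps Ms N a N' \<longleftrightarrow> a \<in> A \<and>
    (\<forall>w\<in>L. \<forall>u\<in>L. \<pi> w \<otimes> \<pi> [a] = \<pi> u \<longrightarrow> (w \<in> fsa_lang N \<longleftrightarrow> u \<in> fsa_lang N'))"
proof -
  have "translate_edge Ps Ms N a N' \<longleftrightarrow> a \<in> A \<and> (\<forall>z\<in>lists (set Ps). z \<in> fsa_lang (m a) \<longrightarrow>
        (somes (map fst z) \<in> fsa_lang N \<longleftrightarrow> somes (map snd z) \<in> fsa_lang N'))"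
    by (auto simp: translate_edge_def Ms)
  also have "\<dots> \<longleftrightarrow> a \<in> A \<and> (\<forall>z. z \<in> fsa_lang (m a) \<longrightarrow>
        (somes (map fst z) \<in> fsa_lang N \<longleftrightarrow> somes (map snd z) \<in> fsa_lang N'))"
    using fsa_lang_subset_lists[OF multiplier(1)] unfolding Ps by blast
  also have "\<dots> \<longleftrightarrow> a \<in> A \<and>
    (\<forall>w\<in>L. \<forall>u\<in>L. \<pi> w \<otimes> \<pi> [a] = \<pi> u \<longrightarrow> (w \<in> fsa_lang N \<longleftrightarrow> u \<in> fsa_lang N'))"
    using multiplier_iff by (metis (no_types, lifting) somes_pad)
  finally show ?thesis .
qed

text \<open>
  By existence of representatives a path can follow any word, and by their uniqueness it has one end.
\<close>

lemma mult_path_iff: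
  "w \<in> L \<Longrightarrow> labelled_path (mult_edge Ms) w x u \<longleftrightarrow> x \<in> lists A \<and> u \<in> L \<and> \<pi> w \<otimes> \<pi> x = \<pi> u"
proof (induction x arbitrary: w)
  case Nil
  then show ?case
    using representative_unique by auto
next
  case (Cons a x)
  show ?case
  proof (cases "a \<in> A \<and> x \<in> lists A")
    case True
    then have a: "\<pi> [a] \<in> carrier G" "\<pi> x \<in> carrier G" "\<pi> (a # x) = \<pi> [a] \<otimes> \<pi> x"
      using word_val_append[of "[a]" x] word_val_closed[of "[a]"] by (simp_all del: word_val_simps)
    obtain v where v: "v \<in> L" "\<pi> w \<otimes> \<pi> [a] = \<pi> v"
      using representative[of "\<pi> w \<otimes> \<pi> [a]"] a Cons.prems by auto
    have "mult_edge Ms w a v' \<longleftrightarrow> v' = v" for v'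
      unfolding mult_edge_iff using True v Cons.prems representative_unique by metis
    then have "labelled_path (mult_edge Ms) w (a # x) u \<longleftrightarrow> labelled_path (mult_edge Ms) v x u"
      by simp
    also have "\<dots> \<longleftrightarrow> x \<in> lists A \<and> u \<in> L \<and> \<pi> v \<otimes> \<pi> x = \<pi> u"
      using Cons.IH[OF v(1)] .
    also have "\<pi> v \<otimes> \<pi> x = \<pi> w \<otimes> \<pi> (a # x)"
      using a Cons.prems v(2)[symmetric] by (simp add: m_assoc del: word_val_simps)
    finally show ?thesis
      using True by simp
  next
    case False
    then show ?thesis
      using Cons.IH by (auto simp: mult_edge_iff)
  qed
qed

lemma mult_path_source: "labelled_path (mult_edge Ms) w x u \<Longrightarrow> u \<in> L \<Longrightarrow> w \<in> L"
  by (cases x) (auto simp: mult_edge_iff)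

lemma translate_path:
  assumes "labelled_path (translate_edge Ps Ms) N x N'" "w \<in> L" "u \<in> L" "\<pi> w \<otimes> \<pi> x = \<pi> u"
  shows "w \<in> fsa_lang N \<longleftrightarrow> u \<in> fsa_lang N'"
  using assms
proof (induction x arbitrary: N w)
  case Nil
  then show ?case
    using representative_unique[of w u] by simp
next
  case (Cons a x)
  then obtain N1 where N1: "translate_edge Ps Ms N a N1" "labelled_path (translate_edge Ps Ms) N1 x N'"
    by auto
  have a: "a \<in> A" 
    using N1(1) by (simp add: translate_edge_iff)
  have x: "x \<in> lists A"
    using N1(2) by (induction x arbitrary: N1) (auto simp: translate_edge_iff)
  have a': "\<pi> [a] \<in> carrier G" "\<pi> (a # x) = \<pi> [a] \<otimes> \<pi> x"
    using a x word_val_append[of "[a]" x] word_val_closed[of "[a]"] by (simp_all del: word_val_simps)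
  obtain v where v: "v \<in> L" "\<pi> w \<otimes> \<pi> [a] = \<pi> v"
    using representative[of "\<pi> w \<otimes> \<pi> [a]"] a' Cons.prems by auto
  have "\<pi> v \<otimes> \<pi> x = \<pi> u"
    using a' x Cons.prems v(2)[symmetric] by (simp add: m_assoc del: word_val_simps)
  from Cons.IH[OF N1(2) v(1) Cons.prems(3) this] show ?case
    using N1(1) v Cons.prems(2) unfolding translate_edge_iff by blast
qed

context
  fixes vs :: "'b list list"
  assumes vs: "set vs \<subseteq> lists A"
begin

abbreviation H :: "'a set" where "H \<equiv> generate G (\<pi> ` set vs)"

lemma generator_closed: "v \<in> set vs \<Longrightarrow> \<pi> v \<in> carrier G"
  using vs word_val_closed by blast

lemma subgroup_H: "subgroup H G"
  by (rule generate_is_subgroup) (use generator_closed in blast)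

text \<open>
  Together with the converse below: the words that generator paths from \<open>e\<close> reach are those of \<open>L\<^sub>H\<close>.
\<close>

lemma generator_path_sound:
  "labelled_path (generator_edge Ms vs) w gs u \<Longrightarrow> w \<in> L \<Longrightarrow> u \<in> L \<and> (\<exists>h\<in>H. \<pi> w \<otimes> h = \<pi> u)"
proof (induction gs arbitrary: w)
  case Nil
  then show ?case
    using subgroup.one_closed[OF subgroup_H] by (auto intro!: bexI[of _ \<one>])
next
  case (Cons v gs)
  then obtain x where x: "generator_edge Ms vs w v x" "labelled_path (generator_edge Ms vs) x gs u"
    by auto
  have v: "\<pi> v \<in> H" "\<pi> v \<in> carrier G" 
    using x(1) generator_closed by (auto simp: generator_edge_def intro: generate.incl)
  have "x \<in> L \<and> (\<exists>h\<in>H. \<pi> w \<otimes> h = \<pi> x)"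
  proof (cases "labelled_path (mult_edge Ms) w v x")
    case True
    then show ?thesis
      using mult_path_iff[OF Cons.prems(2)] v by auto
  next
    case False
    then have *: "labelled_path (mult_edge Ms) x v w"
      using x(1) by (simp add: generator_edge_def)
    then have x': "x \<in> L"
      using mult_path_source Cons.prems(2) by blast
    then have "\<pi> x \<otimes> \<pi> v = \<pi> w"
      using * mult_path_iff by blast
    then have "\<pi> w \<otimes> inv (\<pi> v) = \<pi> x"
      using x' v Cons.prems(2) by (metis L_closed inv_solve_right)
    then show ?thesis
      using x' subgroup.m_inv_closed[OF subgroup_H v(1)] by blast
  qed
  then obtain h where h: "x \<in> L" "h \<in> H" "\<pi> w \<otimes> h = \<pi> x"
    by blast
  from Cons.IH[OF x(2) h(1)] obtain h' where h': "u \<in> L" "h' \<in> H" "\<pi> x \<otimes> h' = \<pi> u"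
    by blast
  have "\<pi> w \<otimes> (h \<otimes> h') = \<pi> u"
    using h h' Cons.prems(2) subgroup.mem_carrier[OF subgroup_H] by (simp flip: m_assoc)
  then show ?case
    using h(2) h'(1,2) subgroup.m_closed[OF subgroup_H] by blast
qed

lemma generator_path_complete:
  "h \<in> H \<Longrightarrow> w \<in> L \<Longrightarrow> u \<in> L \<Longrightarrow> \<pi> w \<otimes> h = \<pi> u \<Longrightarrow> \<exists>gs. labelled_path (generator_edge Ms vs) w gs u"
proof (induction arbitrary: w u rule: generate.induct)
  case one
  then show ?case
    using representative_unique[of w u] by (intro exI[of _ "[]"]) simp
next
  case (incl h)
  then obtain v where v: "v \<in> set vs" "h = \<pi> v"
    by blast
  then have "labelled_path (mult_edge Ms) w v u"
    using incl vs by (simp add: mult_path_iff subset_iff)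
  then show ?case
    using v(1) by (intro exI[of _ "[v]"]) (simp add: generator_edge_def)
next
  case (inv h)
  then obtain v where v: "v \<in> set vs" "h = \<pi> v"
    by blast
  then have c: "\<pi> v \<in> carrier G"
    using generator_closed by blast
  have "\<pi> u \<otimes> \<pi> v = \<pi> w"
    using inv.prems v(2) c by (metis L_closed inv_closed inv_solve_right)
  then have "labelled_path (mult_edge Ms) u v w"
    using inv.prems v vs by (simp add: mult_path_iff subset_iff)
  then show ?case
    using v(1) by (intro exI[of _ "[v]"]) (simp add: generator_edge_def)
next
  case (eng h1 h2)
  have c: "h1 \<in> carrier G" "h2 \<in> carrier G"
    using eng.hyps subgroup.mem_carrier[OF subgroup_H] by blast+
  obtain x where x: "x \<in> L" "\<pi> x = \<pi> w \<otimes> h1"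
    using representative[of "\<pi> w \<otimes> h1"] c eng.prems by auto
  have "\<pi> x \<otimes> h2 = \<pi> u"
    using x eng.prems c by (simp add: m_assoc)
  then obtain gs gs' where "labelled_path (generator_edge Ms vs) w gs x"
    "labelled_path (generator_edge Ms vs) x gs' u"
    using eng.IH(1)[of w x] eng.IH(2)[of x u] x eng.prems by auto
  then show ?case
    by (intro exI[of _ "gs @ gs'"]) (auto simp: labelled_path_append)
qed

lemma same_coset_iff:
  "same_coset Ms e vs x y \<longleftrightarrow> x \<in> lists A \<and> y \<in> lists A \<and> (\<exists>h\<in>H. h \<otimes> \<pi> y = \<pi> x)"
proof
  assume "same_coset Ms e vs x y"
  then obtain gs h w where "labelled_path (generator_edge Ms vs) e gs h"
     "labelled_path (mult_edge Ms) h y w" "labelled_path (mult_edge Ms) e x w"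
    by (auto simp: same_coset_def)
  then have *: "x \<in> lists A" "y \<in> lists A" "h \<in> L" "\<pi> h \<in> H" "\<pi> h \<otimes> \<pi> y = \<pi> w" "\<one> \<otimes> \<pi> x = \<pi> w"
    using generator_path_sound[of e gs h] e mult_path_iff subgroup.mem_carrier[OF subgroup_H]
    by (auto simp: mult_path_iff)
  have "\<pi> x = \<pi> w"
    using * by (metis word_val_closed l_one)
  with * show "x \<in> lists A \<and> y \<in> lists A \<and> (\<exists>h\<in>H. h \<otimes> \<pi> y = \<pi> x)"
    by auto
next
  assume *: "x \<in> lists A \<and> y \<in> lists A \<and> (\<exists>h\<in>H. h \<otimes> \<pi> y = \<pi> x)"
  then obtain h where h: "h \<in> H" "h \<otimes> \<pi> y = \<pi> x"
    by blast
  have c: "h \<in> carrier G"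
    using h(1) subgroup.mem_carrier[OF subgroup_H] by blast
  obtain k w where k: "k \<in> L" "\<pi> k = h" and w: "w \<in> L" "\<pi> w = \<pi> x"
    using representative c * word_val_closed by metis
  obtain gs where "labelled_path (generator_edge Ms vs) e gs k"
    using generator_path_complete[of h e k] h(1) e k c by auto
  moreover have "labelled_path (mult_edge Ms) k y w" "labelled_path (mult_edge Ms) e x w"
    using * k w h e by (simp_all add: mult_path_iff)
  ultimately show "same_coset Ms e vs x y"
    by (auto simp: same_coset_def)
qed

text \<open>
  The coset labels put the language of \<open>N\<close> inside \<open>H\<close>. Conversely a word of \<open>L\<^sub>H\<close> is reached from \<open>e\<close>
  by a generator path, and each step of the path preserves membership in the language of \<open>N\<close>.
\<close>

lemma certified_sound:
  assumes "certified As Ps Ms M e vs N"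
  shows "fsa_over A N" and "fsa_lang N = preimage_in G \<mu> L H"
proof -
  obtain D where D: "coset_labelling Ms e vs N D" and e': "e \<in> fsa_lang N"
    and over: "\<forall>t\<in>set (table N). snd (fst t) \<in> A"
    and L: "\<forall>w\<in>lists A. w \<in> fsa_lang N \<longrightarrow> w \<in> L"
    and vs': "\<forall>v\<in>set vs. labelled_path (translate_edge Ps Ms) N v N"
    using assms by (auto simp: certified_def)
  show over': "fsa_over A N"
    using over by (auto simp: fsa_over_def)
  have D0: "(initial N, []) \<in> set D"
    and D1: "\<And>d t. d \<in> set D \<Longrightarrow> t \<in> set (table N) \<Longrightarrow> fst (fst t) = fst d \<Longrightarrow>
      \<exists>d'\<in>set D. fst d' = snd t \<and> same_coset Ms e vs (snd d @ [snd (fst t)]) (snd d')"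
    and D2: "\<And>d. d \<in> set D \<Longrightarrow> fst d \<in> set (accepting N) \<Longrightarrow> same_coset Ms e vs (snd d) []"
    using D unfolding coset_labelling_def by blast+
  have run: "\<exists>c. (q, c) \<in> set D \<and> same_coset Ms e vs w c"
    if "fsa_run N (initial N) w = Some q" for w q
    using that
  proof (induction w arbitrary: q rule: rev_induct)
    case Nil
    then show ?case
      using D0 subgroup.one_closed[OF subgroup_H]
      by (auto simp: same_coset_iff intro!: exI[of _ "[]"] bexI[of _ \<one>])
  next
    case (snoc a w)
    then obtain p where p: "fsa_run N (initial N) w = Some p" "map_of (table N) (p, a) = Some q"
      by (auto simp: fsa_run_append split: option.splits)
    obtain c where c: "(p, c) \<in> set D" "same_coset Ms e vs w c"
      using snoc.IH[OF p(1)] by blast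
    have "((p, a), q) \<in> set (table N)"
      using p(2) by (rule map_of_SomeD)
    from D1[OF c(1) this] obtain c' where c': "(q, c') \<in> set D" "same_coset Ms e vs (c @ [a]) c'"
      by auto
    obtain h h' where h: "h \<in> H" "h \<otimes> \<pi> c = \<pi> w" "w \<in> lists A" "c \<in> lists A"
      and h': "h' \<in> H" "h' \<otimes> \<pi> c' = \<pi> (c @ [a])" "c' \<in> lists A" "[a] \<in> lists A"
      using c(2) c'(2) by (auto simp: same_coset_iff simp del: word_val_simps)
    have "(h \<otimes> h') \<otimes> \<pi> c' = \<pi> (w @ [a])"
      using h h' subgroup.mem_carrier[OF subgroup_H]
      by (simp add: word_val_append m_assoc del: word_val_simps flip: h(2))
    moreover have "h \<otimes> h' \<in> H"
      using h h' subgroup.m_closed[OF subgroup_H] by blast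
    ultimately have "same_coset Ms e vs (w @ [a]) c'"
      unfolding same_coset_iff using h h' by auto
    then show ?case
      using c'(1) by blast
  qed
  have in_H: "\<pi> w \<in> H" if w: "w \<in> fsa_lang N" for w
  proof -
    obtain q where q: "fsa_run N (initial N) w = Some q" "q \<in> set (accepting N)"
      using w by (auto simp: fsa_lang_def)
    obtain c where c: "(q, c) \<in> set D" "same_coset Ms e vs w c"
      using run[OF q(1)] by blast
    have "same_coset Ms e vs c []"
      using D2[OF c(1)] q(2) by simp
    then have "\<pi> c \<in> H"
      using subgroup.mem_carrier[OF subgroup_H] by (auto simp: same_coset_iff)
    then show ?thesis
      using c(2) subgroup.m_closed[OF subgroup_H] unfolding same_coset_iff by metis
  qed
  have edge: "x \<in> L \<and> (w \<in> fsa_lang N \<longleftrightarrow> x \<in> fsa_lang N)"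
    if "generator_edge Ms vs w v x" "w \<in> L" for w v x
  proof -
    have x: "x \<in> L"
      using that mult_path_iff mult_path_source by (auto simp: generator_edge_def)
    have "labelled_path (translate_edge Ps Ms) N v N"
      using that(1) vs' by (simp add: generator_edge_def)
    from translate_path[OF this] show ?thesis
      using that x by (auto simp: generator_edge_def mult_path_iff)
  qed
  have path: "w \<in> fsa_lang N \<longleftrightarrow> u \<in> fsa_lang N"
    if "labelled_path (generator_edge Ms vs) w gs u" "w \<in> L" for w gs u
    using that
  proof (induction gs arbitrary: w)
    case (Cons v gs)
    then obtain x where "generator_edge Ms vs w v x" "labelled_path (generator_edge Ms vs) x gs u"
      by auto
    then show ?case
      using edge[of w v x] Cons by blast
  qed simp
  have "u \<in> fsa_lang N" if "u \<in> L" "\<pi> u \<in> H" for u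
    using generator_path_complete[of "\<pi> u" e u] path[of e _ u] e e' that by auto
  then show "fsa_lang N = preimage_in G \<mu> L H"
    using in_H L fsa_lang_subset_lists[OF over'] by (auto simp: preimage_in_def)
qed

text \<open>
  \<open>K g\<close> collects the words of \<open>L\<close> that \<open>g\<close> takes into \<open>H\<close>. These languages are regular, starting from
  \<open>K [] = L\<^sub>H\<close> and adding letters in front of \<open>g\<close>; automata for them form the chains, which close up
  to loops at \<open>N\<close> because \<open>K v = K []\<close> for a generator \<open>v\<close>. As the label of a state serves a word that
  leads to it.
\<close>

lemma certified_complete:
  assumes "rational_subgroup G A \<mu> L H"
  shows "\<exists>N. certified As Ps Ms M e vs N"
proof -
  define K where "K g = {w \<in> L. \<pi> w \<otimes> \<pi> g \<in> H}" for g
  have K_Nil: "K [] = preimage_in G \<mu> L H"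
    by (auto simp: K_def preimage_in_def)
  have K_Cons: "K (a # g) = {w. \<exists>u\<in>K g. (w, u) \<in> {(w, u). w \<in> L \<and> u \<in> L \<and> \<pi> (w @ [a]) = \<pi> u}}"
    if "a # g \<in> lists A" for a g
  proof -
    have c: "\<mu> a \<in> carrier G" "\<pi> g \<in> carrier G" "[a] \<in> lists A"
      using that gens by auto
    have "w \<in> K (a # g) \<longleftrightarrow> (\<exists>u\<in>K g. w \<in> L \<and> u \<in> L \<and> \<pi> (w @ [a]) = \<pi> u)" for w
    proof -
      have "\<pi> (w @ [a]) = \<pi> w \<otimes> \<mu> a" if "w \<in> L"
        using that c word_val_append[OF L_lists[OF that] c(3)] by simp
      then show ?thesis
        using representative[of "\<pi> w \<otimes> \<mu> a"] c by (force simp: K_def m_assoc)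
    qed
    then show ?thesis
      by auto
  qed
  obtain N0 where N0: "fsa_lang N0 = K []"
    using assms by (auto simp: rational_subgroup_def regular_def K_Nil)
  have K_sub: "K g \<subseteq> lists A" for g
    using L_lists by (auto simp: K_def)
  have "finite (range (residual (K [])))"
    using finite_residuals_fsa_lang[of N0] N0 by simp
  then obtain N where N: "fsa_over A N" "fsa_lang N = K []" "trim_fsa N"
    using ex_trim_fsa[OF _ K_sub] by blast
  have K_fsa: "\<exists>N'. fsa_lang N' = K g" if "g \<in> lists A" for g
    using that
  proof (induction g rule: list.induct)
    case (Cons a g)
    then obtain N' where N': "fsa_lang N' = K g"
      by auto
    have "a \<in> A"
      using Cons.prems by simp
    moreover have "K (a # g) = {w. \<exists>u\<in>fsa_lang N'.
        (w, u) \<in> {(w, u). w \<in> L \<and> u \<in> L \<and> \<pi> (w @ [a]) = \<pi> u}}"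
      using K_Cons[OF Cons.prems] N' by simp
    ultimately have "finite (range (residual (K (a # g))))"
      using finite_residuals_projection multiplier(2) by blast
    then show ?case
      using ex_trim_fsa[OF _ K_sub] by blast
  qed (use N in blast)
  \<comment> \<open>The automaton depends on the language alone, so that a chain for a generator ends where it starts.\<close>
  define aut where "aut g = (if K g = K [] then N else SOME N'. fsa_lang N' = K g)" for g
  have aut: "fsa_lang (aut g) = K g" if "g \<in> lists A" for g
    using someI_ex[OF K_fsa[OF that]] N(2) by (simp add: aut_def)
  have aut_path: "labelled_path (translate_edge Ps Ms) (aut g) g N" if "g \<in> lists A" for g
    using that
  proof (induction g rule: list.induct)
    case (Cons a g)
    have "translate_edge Ps Ms (aut (a # g)) a (aut g)"
      unfolding translate_edge_iff using Cons.prems aut[of g] aut[of "a # g"]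
      by (auto simp: K_Cons word_val_append L_lists simp del: word_val_simps
        dest: representative_unique)
    then show ?case
      using Cons by auto
  qed (simp add: aut_def)
  have mem_H: "g \<otimes> h \<in> H \<longleftrightarrow> g \<in> H" if "g \<in> carrier G" "h \<in> H" for g h
    using that subgroup_H by (metis subgroup.m_closed subgroup.mem_carrier subgroup.m_inv_closed
      inv_closed inv_solve_right m_closed)
  have loops: "labelled_path (translate_edge Ps Ms) N v N" if "v \<in> set vs" for v
  proof -
    have "\<pi> v \<in> H"
      using that by (auto intro: generate.incl)
    then have "K v = K []"
      by (auto simp: K_def mem_H)
    then have "aut v = N"
      by (simp add: aut_def)
    with aut_path[of v] show ?thesis
      using that vs by auto
  qed
  have run_H: "\<pi> x \<in> H" if "x \<in> fsa_lang N" for x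
    using that N(2) by (auto simp: K_def)
  define Q where "Q = insert (initial N) (snd ` set (table N))"
  \<comment> \<open>The initial state must have the empty label, whatever other words lead back to it.\<close>
  define access where "access q = (if q = initial N then [] else SOME w. fsa_run N (initial N) w = Some q)" for q
  have access: "fsa_run N (initial N) (access q) = Some q" if "fsa_run N (initial N) w = Some q" for w q
    using someI[of "\<lambda>w. fsa_run N (initial N) w = Some q", OF that] by (simp add: access_def)
  obtain qs where qs: "set qs = {q. \<exists>w. fsa_run N (initial N) w = Some q}"
  proof -
    have "{q. \<exists>w. fsa_run N (initial N) w = Some q} \<subseteq> Q"
      using fsa_run_in_table by (force simp: Q_def)
    then have "finite {q. \<exists>w. fsa_run N (initial N) w = Some q}"
      by (rule finite_subset) (simp add: Q_def)
    then show ?thesis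
      using finite_list that by blast
  qed
  have access_lists: "access q \<in> lists A" if "q \<in> set qs" for q
    using that access fsa_run_in_lists[OF N(1)] unfolding qs by blast
  define D where "D = map (\<lambda>q. (q, access q)) qs"
  have "coset_labelling Ms e vs N D"
    unfolding coset_labelling_def
  proof (intro conjI ballI)
    show "(initial N, []) \<in> set D"
      by (auto simp: D_def qs access_def intro!: image_eqI[of _ _ "initial N"] exI[of _ "[]"])
  next
    fix d t
    assume d: "d \<in> set D" and t: "t \<in> set (table N)"
    obtain q where q: "d = (q, access q)" "q \<in> set qs"
      using d by (auto simp: D_def)
    obtain p a q' where t': "t = ((p, a), q')"
      by (metis surj_pair)
    show "fst (fst t) \<noteq> fst d \<or> (\<exists>d'\<in>set D. fst d' = snd t \<and>
        same_coset Ms e vs (snd d @ [snd (fst t)]) (snd d'))"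
    proof (cases "p = q")
      case True
      then obtain y r where tr: "map_of (table N) (q, a) = Some q'" "r \<in> set (accepting N)"
          "fsa_run N q' y = Some r"
        using N(3) t t' unfolding trim_fsa_def by blast
      have run_q: "fsa_run N (initial N) (access q) = Some q"
        using q(2) access by (auto simp: qs)
      then have run_q': "fsa_run N (initial N) (access q @ [a]) = Some q'"
        using tr(1) by (simp add: fsa_run_append)
      then have q': "q' \<in> set qs" "fsa_run N (initial N) (access q') = Some q'"
        using access by (auto simp: qs)
      have "fsa_run N (initial N) ((access q @ [a]) @ y) = Some r"
        "fsa_run N (initial N) (access q' @ y) = Some r"
        by (simp_all only: fsa_run_append[of N _ _ y] run_q' q'(2) option.case tr(3))
      then have "(access q @ [a]) @ y \<in> fsa_lang N" "access q' @ y \<in> fsa_lang N"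
        unfolding fsa_lang_def using tr(2) by blast+
      then have H: "\<pi> ((access q @ [a]) @ y) \<in> H" "\<pi> (access q' @ y) \<in> H"
        using run_H by blast+
      have l: "access q @ [a] \<in> lists A" "access q' \<in> lists A" "y \<in> lists A"
        using fsa_run_in_lists[OF N(1)] run_q' q'(2) tr(3) by blast+
      define g g' where "g = \<pi> (access q @ [a])" and "g' = \<pi> (access q')"
      have c: "g \<in> carrier G" "g' \<in> carrier G" "\<pi> y \<in> carrier G"
        using l word_val_closed unfolding g_def g'_def by blast+
      have H': "g \<otimes> \<pi> y \<in> H" "g' \<otimes> \<pi> y \<in> H"
        using H l word_val_append unfolding g_def g'_def by metis+
      have "(g \<otimes> \<pi> y) \<otimes> inv (g' \<otimes> \<pi> y) \<otimes> g' = g \<otimes> (\<pi> y \<otimes> inv (\<pi> y)) \<otimes> (inv g' \<otimes> g')"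
        using c by (simp add: inv_mult_group m_assoc del: r_inv l_inv)
      also have "\<dots> = g"
        using c by simp
      finally have "(g \<otimes> \<pi> y) \<otimes> inv (g' \<otimes> \<pi> y) \<otimes> g' = g" .
      moreover have "(g \<otimes> \<pi> y) \<otimes> inv (g' \<otimes> \<pi> y) \<in> H"
        using H' subgroup_H by (meson subgroup.m_closed subgroup.m_inv_closed)
      ultimately have "same_coset Ms e vs (access q @ [a]) (access q')"
        unfolding same_coset_iff using l g_def g'_def by blast
      then show ?thesis
        using q' t' q by (intro disjI2 bexI[of _ "(q', access q')"]) (auto simp: D_def)
    qed (use t' q in simp)
  next
    fix d
    assume d: "d \<in> set D"
    then obtain q where q: "d = (q, access q)" "q \<in> set qs"
      by (auto simp: D_def)
    have "same_coset Ms e vs (access q) []" if "q \<in> set (accepting N)"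
      unfolding same_coset_iff
    proof (intro conjI bexI)
      show l: "access q \<in> lists A" "[] \<in> lists A"
        using access_lists[OF q(2)] by simp_all
      show "\<pi> (access q) \<otimes> \<pi> [] = \<pi> (access q)"
        using word_val_closed[OF l(1)] unfolding word_val_simps by (rule r_one)
      have "access q \<in> fsa_lang N"
        using that q(2) access by (auto simp: fsa_lang_def qs)
      then show "\<pi> (access q) \<in> H"
        by (rule run_H)
    qed
    then show "fst d \<notin> set (accepting N) \<or> same_coset Ms e vs (snd d) []"
      using q by auto
  qed
  moreover have "e \<in> fsa_lang N"
    using e subgroup.one_closed[OF subgroup_H] N(2) by (simp add: K_def)
  moreover have "\<forall>t\<in>set (table N). snd (fst t) \<in> A"
    using N(1) by (auto simp: fsa_over_def)
  moreover have "\<forall>w\<in>lists A. w \<in> fsa_lang N \<longrightarrow> w \<in> L"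
    using N(2) by (auto simp: K_def)
  ultimately have "certified As Ps Ms M e vs N"
    using loops by (auto simp: certified_def)
  then show ?thesis ..
qed

end

end

section \<open>Certificates can be searched for\<close>

lemma computable_fsa_tuple: "computable f \<Longrightarrow> computable (\<lambda>x. fsa_tuple (f x))"
  by (rule computable_compose[OF computable_same_code]) (simp_all add: encode_fsa_def)

lemma computable_fsa_selectors [computable_intros]:
  assumes "computable f"
  shows "computable (\<lambda>x. initial (f x))" "computable (\<lambda>x. table (f x))"
    "computable (\<lambda>x. accepting (f x))"
  using computable_fst[OF computable_fsa_tuple[OF assms]]
    computable_fst[OF computable_snd[OF computable_fsa_tuple[OF assms]]]
    computable_snd[OF computable_snd[OF computable_fsa_tuple[OF assms]]]
  by (simp_all add: fsa_tuple_def)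

lemma computable_map_of [computable_intros]:
  fixes l :: "'x::encodable \<Rightarrow> ('k::encodable \<times> 'v::encodable) list"
  assumes l: "computable l" and k: "computable k"
  shows "computable (\<lambda>x. map_of (l x) (k x))"
proof -
  have "computable (\<lambda>x. foldr (\<lambda>p r. if fst p = k x then Some (snd p) else r) (l x) None)"
    by (intro computable_intros decidable_intros l computable_compose[OF k])
  moreover have "foldr (\<lambda>p r. if fst p = k' then Some (snd p) else r) l' None = map_of l' k'"
    for k' :: 'k and l' :: "('k \<times> 'v) list"
    by (induction l') auto
  ultimately show ?thesis
    by simp
qed

definition fsa_step :: "'a fsa \<Rightarrow> nat option \<Rightarrow> 'a \<Rightarrow> nat option" where
  "fsa_step M s a = (case s of None \<Rightarrow> None | Some q \<Rightarrow> map_of (table M) (q, a))"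

definition accepting_state :: "'a fsa \<Rightarrow> nat option \<Rightarrow> bool" where
  "accepting_state M s \<longleftrightarrow> (\<exists>q\<in>set (accepting M). s = Some q)"

lemma foldl_fsa_step: "foldl (fsa_step M) (Some q) w = fsa_run M q w"
proof -
  have "foldl (fsa_step M) s w = (case s of None \<Rightarrow> None | Some q \<Rightarrow> fsa_run M q w)" for s
    by (induction w arbitrary: s) (auto simp: fsa_step_def split: option.split)
  then show ?thesis
    by simp
qed

lemma fsa_lang_iff: "w \<in> fsa_lang M \<longleftrightarrow> accepting_state M (foldl (fsa_step M) (Some (initial M)) w)"
  by (auto simp: fsa_lang_def accepting_state_def foldl_fsa_step)

lemma computable_fsa_step [computable_intros]:
  assumes "computable f" "computable s" "computable a"
  shows "computable (\<lambda>x. fsa_step (f x) (s x) (a x))"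
  unfolding fsa_step_def
  by (intro computable_intros assms computable_compose[OF assms(1)] computable_compose[OF assms(3)])

lemma decidable_accepting_state [decidable_intros]:
  assumes "computable f" "computable s"
  shows "decidable (\<lambda>x. accepting_state (f x) (s x))"
  unfolding accepting_state_def
  by (intro decidable_intros computable_intros assms computable_compose[OF assms(2)])

lemma decidable_fsa_lang [decidable_intros]:
  assumes "computable f" "computable w"
  shows "decidable (\<lambda>x. w x \<in> fsa_lang (f x))"
  unfolding fsa_lang_iff
  by (intro decidable_intros computable_intros assms computable_compose[OF assms(1)])

lemma computable_somes [computable_intros]:
  assumes "computable f"
  shows "computable (\<lambda>x. somes (f x))"
  unfolding somes_def by (intro computable_intros assms)

text \<open>One head of a two-tape automaton: it does not move on a padding symbol.\<close>

definition head_step :: "'a fsa \<Rightarrow> nat option \<Rightarrow> 'a option \<Rightarrow> nat option" where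
  "head_step M s x = (case x of None \<Rightarrow> s | Some a \<Rightarrow> fsa_step M s a)"

lemma foldl_head_step: "foldl (head_step M) s xs = foldl (fsa_step M) s (somes xs)"
  by (induction xs arbitrary: s) (auto simp: head_step_def split: option.split)

lemma computable_head_step [computable_intros]:
  assumes "computable f" "computable s" "computable a"
  shows "computable (\<lambda>x. head_step (f x) (s x) (a x))"
  unfolding head_step_def
  by (intro computable_intros assms computable_compose[OF assms(1)] computable_compose[OF assms(2)])

lemma finite_fsa_states: "finite (range (foldl (fsa_step M) (Some q)))"
  using finite_range_fsa_run[of M q] by (simp add: foldl_fsa_step[abs_def])

text \<open>
  An invariant of the product automaton contains only pairs of states that agree with the inclusion.
\<close>

lemma semidecidable_fsa_lang_subset:
  fixes as :: "'a::encodable list"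
  assumes N: "computable N" and M: "computable M"
  shows "semidecidable (\<lambda>x. \<forall>w\<in>lists (set as). w \<in> fsa_lang (N x) \<longrightarrow> w \<in> fsa_lang (M x))"
proof -
  define f :: "'a fsa \<times> 'a fsa \<Rightarrow> nat option \<times> nat option \<Rightarrow> 'a \<Rightarrow> nat option \<times> nat option"
    where "f x s a = (fsa_step (fst x) (fst s) a, fsa_step (snd x) (snd s) a)" for x s a
  define s :: "'a fsa \<times> 'a fsa \<Rightarrow> nat option \<times> nat option"
    where "s x = (Some (initial (fst x)), Some (initial (snd x)))" for x
  have fold: "foldl (f x) t w = (foldl (fsa_step (fst x)) (fst t) w, foldl (fsa_step (snd x)) (snd t) w)"
    for x t w
    by (induction w arbitrary: t) (simp_all add: f_def)
  have "semidecidable (\<lambda>x. \<forall>w\<in>lists (set as).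
      (\<lambda>x t. accepting_state (fst x) (fst t) \<longrightarrow> accepting_state (snd x) (snd t)) x (foldl (f x) (s x) w))"
  proof (rule semidecidable_all_words)
    show "finite (foldl (f x) (s x) ` lists (set as))" for x
    proof (rule finite_subset)
      show "foldl (f x) (s x) ` lists (set as) \<subseteq>
        range (foldl (fsa_step (fst x)) (Some (initial (fst x)))) \<times>
        range (foldl (fsa_step (snd x)) (Some (initial (snd x))))"
        by (auto simp: fold s_def)
    qed (intro finite_cartesian_product finite_fsa_states)
  qed (unfold f_def s_def, (intro decidable_intros computable_intros)+)
  from semidecidable_compose[OF this computable_Pair[OF N M]] show ?thesis
    by (simp add: fold s_def fsa_lang_iff)
qed

text \<open>
  The product of \<open>m\<close> with one head of \<open>N\<close> and one of \<open>N'\<close> has finitely many reachable states, so an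
  invariant confirms the correspondence for all pairs accepted by \<open>m\<close>.
\<close>

lemma semidecidable_translation:
  fixes as :: "('a::encodable option \<times> 'a option) list"
  assumes m: "computable m" and N: "computable N" and N': "computable N'"
  shows "semidecidable (\<lambda>x. \<forall>z\<in>lists (set as). z \<in> fsa_lang (m x) \<longrightarrow>
    (somes (map fst z) \<in> fsa_lang (N x) \<longleftrightarrow> somes (map snd z) \<in> fsa_lang (N' x)))"
proof -
  define f :: "('a option \<times> 'a option) fsa \<times> 'a fsa \<times> 'a fsa \<Rightarrow> nat option \<times> nat option \<times> nat option \<Rightarrow>
      'a option \<times> 'a option \<Rightarrow> nat option \<times> nat option \<times> nat option"
    where "f x s a = (fsa_step (fst x) (fst s) a, head_step (fst (snd x)) (fst (snd s)) (fst a),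
      head_step (snd (snd x)) (snd (snd s)) (snd a))" for x s a
  define s :: "('a option \<times> 'a option) fsa \<times> 'a fsa \<times> 'a fsa \<Rightarrow> nat option \<times> nat option \<times> nat option"
    where "s x = (Some (initial (fst x)), Some (initial (fst (snd x))), Some (initial (snd (snd x))))" for x
  have fold: "foldl (f x) t z = (foldl (fsa_step (fst x)) (fst t) z,
      foldl (fsa_step (fst (snd x))) (fst (snd t)) (somes (map fst z)),
      foldl (fsa_step (snd (snd x))) (snd (snd t)) (somes (map snd z)))" for x t z
    unfolding foldl_head_step[symmetric] by (induction z arbitrary: t) (simp_all add: f_def)
  have "semidecidable (\<lambda>x. \<forall>z\<in>lists (set as).
      (\<lambda>x t. accepting_state (fst x) (fst t) \<longrightarrow>
        (accepting_state (fst (snd x)) (fst (snd t)) \<longleftrightarrow> accepting_state (snd (snd x)) (snd (snd t))))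
      x (foldl (f x) (s x) z))"
  proof (rule semidecidable_all_words)
    show "finite (foldl (f x) (s x) ` lists (set as))" for x
    proof (rule finite_subset)
      show "foldl (f x) (s x) ` lists (set as) \<subseteq>
        range (foldl (fsa_step (fst x)) (Some (initial (fst x)))) \<times>
        range (foldl (fsa_step (fst (snd x))) (Some (initial (fst (snd x))))) \<times>
        range (foldl (fsa_step (snd (snd x))) (Some (initial (snd (snd x)))))"
        by (auto simp: fold s_def)
    qed (intro finite_cartesian_product finite_fsa_states)
  qed (unfold f_def s_def, (intro decidable_intros computable_intros)+)
  from semidecidable_compose[OF this computable_Pair[OF m computable_Pair[OF N N']]] show ?thesis
    by (simp add: fold s_def fsa_lang_iff)
qed

context
  fixes As :: "'a::encodable list" and Ps :: "('a option \<times> 'a option) list"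
    and Ms :: "('a \<times> ('a option \<times> 'a option) fsa) list"
begin

lemma semidecidable_mult_edge:
  assumes "computable w" "computable a" "computable u"
  shows "semidecidable (\<lambda>x. mult_edge Ms (w x) (a x) (u x))"
  unfolding mult_edge_def
  by (intro semidecidable_intros; (rule semidecidable_decidable)?;
    intro decidable_intros computable_intros assms[THEN computable_compose])

lemma semidecidable_mult_path:
  assumes "computable s" "computable w" "computable t"
  shows "semidecidable (\<lambda>x. labelled_path (mult_edge Ms) (s x) (w x) (t x))"
  by (rule semidecidable_labelled_path[of "\<lambda>_ :: nat. mult_edge Ms" "\<lambda>_. 0"])
    (intro semidecidable_mult_edge computable_intros assms)+

lemma semidecidable_translate_edge:
  assumes "computable N" "computable a" "computable N'"
  shows "semidecidable (\<lambda>x. translate_edge Ps Ms (N x) (a x) (N' x))"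
  unfolding translate_edge_def
  by (intro semidecidable_intros semidecidable_translation; (rule semidecidable_decidable)?;
    intro decidable_intros computable_intros assms[THEN computable_compose])

lemma semidecidable_translate_path:
  assumes "computable s" "computable w" "computable t"
  shows "semidecidable (\<lambda>x. labelled_path (translate_edge Ps Ms) (s x) (w x) (t x))"
  by (rule semidecidable_labelled_path[of "\<lambda>_ :: nat. translate_edge Ps Ms" "\<lambda>_. 0"])
    (intro semidecidable_translate_edge computable_intros assms)+

lemma semidecidable_generator_path:
  assumes "computable vs" "computable s" "computable w" "computable t"
  shows "semidecidable (\<lambda>x. labelled_path (generator_edge Ms (vs x)) (s x) (w x) (t x))"
proof (rule semidecidable_labelled_path[of "generator_edge Ms" vs])
  show "semidecidable (\<lambda>y. generator_edge Ms (fst y) (fst (snd y)) (fst (snd (snd y))) (snd (snd (snd y))))"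
    unfolding generator_edge_def
    by (intro semidecidable_conj semidecidable_disj semidecidable_mult_path semidecidable_decidable
      decidable_intros computable_intros)
qed fact+

lemma semidecidable_same_coset:
  assumes "computable vs" "computable x" "computable y"
  shows "semidecidable (\<lambda>z. same_coset Ms e (vs z) (x z) (y z))"
  unfolding same_coset_def
  by (intro semidecidable_ex semidecidable_conj semidecidable_generator_path semidecidable_mult_path
    computable_intros assms[THEN computable_compose])

lemma semidecidable_coset_labelling:
  assumes "computable vs" "computable N" "computable D"
  shows "semidecidable (\<lambda>x. coset_labelling Ms e (vs x) (N x) (D x))"
  unfolding coset_labelling_def
  by (intro semidecidable_intros semidecidable_same_coset; (rule semidecidable_decidable)?;
    intro decidable_intros computable_intros assms[THEN computable_compose] assms)

lemma semidecidable_certified: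
  assumes "computable vs" "computable N"
  shows "semidecidable (\<lambda>x. certified As Ps Ms M e (vs x) (N x))"
  unfolding certified_def
  by (intro semidecidable_conj semidecidable_ex semidecidable_Ball semidecidable_translate_path
      semidecidable_coset_labelling semidecidable_fsa_lang_subset; (rule semidecidable_decidable)?;
    intro decidable_intros computable_intros assms[THEN computable_compose] assms)

end

section \<open>The search for the automaton of a rational subgroup\<close>

theorem proposition1:
  fixes n :: nat and rs :: "letter list list"
    and M :: "letter fsa"
    and Meq :: "(letter option \<times> letter option) fsa"
    and Mmul :: "letter \<Rightarrow> (letter option \<times> letter option) fsa"
  defines "G \<equiv> presented_group n rs"
    and "A \<equiv> letters n"
    and "\<mu> \<equiv> presented_gen n rs"
  assumes relators: "set rs \<subseteq> lists A"
    and automatic: "automatic_structure_unique G A \<mu> M Meq Mmul"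
  shows "\<exists>p :: program. \<forall>vs. set vs \<subseteq> lists A \<longrightarrow>
    (let H = generate G (word_val G \<mu> ` set vs) in
      (rational_subgroup G A \<mu> (fsa_lang M) H \<longrightarrow>
        (\<exists>M\<^sub>H. computes p [words_code vs] (fsa_code M\<^sub>H) \<and>
              fsa_over A M\<^sub>H \<and> fsa_lang M\<^sub>H = preimage_in G \<mu> (fsa_lang M) H)) \<and>
      (\<not> rational_subgroup G A \<mu> (fsa_lang M) H \<longrightarrow>
        runs_forever p [words_code vs]))"
proof -
  have "finite A"
    by (simp add: A_def letters_def)
  then obtain As where As: "set As = A"
    using finite_list by blast
  have "finite (pad_alphabet A)"
    using \<open>finite A\<close> by (simp add: pad_alphabet_def)
  then obtain Ps where Ps: "set Ps = pad_alphabet A"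
    using finite_list by blast
  define Ms where "Ms = map (\<lambda>a. (a, Mmul a)) As"
  interpret group G
    unfolding G_def using relators by (intro group_presented_group) (simp add: A_def)
  obtain e where e: "e \<in> fsa_lang M" "word_val G \<mu> e = \<one>\<^bsub>G\<^esub>"
    using automatic one_closed unfolding automatic_structure_unique_def by blast
  interpret automatic_group G \<mu> M Meq Mmul As Ps Ms e
  proof unfold_locales
    show "\<mu> \<in> set As \<rightarrow> carrier G"
      using presented_gen_closed[of rs n] relators by (auto simp: As A_def G_def \<mu>_def)
  qed (simp_all add: As Ps Ms_def automatic e)
  have "semidecidable (\<lambda>y. certified As Ps Ms M e (fst y) (snd y))"
    by (intro semidecidable_certified computable_intros)
  then obtain p
    where p: "\<And>vs y. computes p [encode vs] y \<Longrightarrow>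
        \<exists>N. y = encode N \<and> certified As Ps Ms M e (fst (vs, N)) (snd (vs, N))"
      and p': "\<And>vs N. certified As Ps Ms M e (fst (vs, N)) (snd (vs, N)) \<Longrightarrow>
        \<not> runs_forever p [encode vs]"
    by (rule semidecidable_search) blast
  have p: "\<exists>N. y = fsa_code N \<and> certified As Ps Ms M e vs N" if "computes p [words_code vs] y" for vs y
    using p[of vs y] that by (simp add: encode_words encode_letter_fsa)
  have p': "\<not> runs_forever p [words_code vs]" if "certified As Ps Ms M e vs N" for vs N
    using p'[of vs N] that by (simp add: encode_words)
  show ?thesis
  proof (intro exI[of _ p] allI impI, unfold Let_def, intro conjI impI)
    fix vs
    assume vs: "set vs \<subseteq> lists A"
    then have vs': "set vs \<subseteq> lists (set As)"
      by (simp add: As)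
    note sound = certified_sound[OF vs', unfolded As]
    {
      assume "rational_subgroup G A \<mu> (fsa_lang M) (generate G (word_val G \<mu> ` set vs))"
      then obtain N where "certified As Ps Ms M e vs N"
        using certified_complete[OF vs'] As by auto
      then obtain y where y: "computes p [words_code vs] y"
        using p' by (auto simp: runs_forever_def)
      then obtain N' where "y = fsa_code N'" "certified As Ps Ms M e vs N'"
        using p by blast
      then show "\<exists>M\<^sub>H. computes p [words_code vs] (fsa_code M\<^sub>H) \<and> fsa_over A M\<^sub>H \<and>
          fsa_lang M\<^sub>H = preimage_in G \<mu> (fsa_lang M) (generate G (word_val G \<mu> ` set vs))"
        using y sound by blast
    next
      assume not_rational: "\<not> rational_subgroup G A \<mu> (fsa_lang M) (generate G (word_val G \<mu> ` set vs))"
      have "rational_subgroup G A \<mu> (fsa_lang M) (generate G (word_val G \<mu> ` set vs))"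
        if "certified As Ps Ms M e vs N" for N
        using sound[OF that] subgroup_H[OF vs'] by (auto simp: rational_subgroup_def regular_def)
      then show "runs_forever p [words_code vs]"
        using not_rational p by (auto simp: runs_forever_def)
    }
  qed
qed

end
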